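(* Let $A\in\mathbb{R}^{d\times d}$ and let $E$ be a linear subspace of $\mathbb{R}^d$. Consider the ODE $\dot x(t)=Ax(t)$, $x(0)\in\mathbb{R}^d$. Then the following statements are equivalent: (1) $E$ is invariant under $A$ (i.e. $x\in E\Rightarrow Ax\in E$), and $E\supseteq E_{A,\ge0}$, where $E_{A,\ge 0}$ denotes the linear subspace spanned by all generalized eigenvectors associated with eigenvalues of $A$ whose real parts are greater than or equal to zero. (2) There exists a seminorm $p$ with $\ker(p)=E$ such that the ODE is globally exponentially stable with respect to $p$. (3) For any seminorm $p$ with $\ker(p)=E$, the ODE is globally exponentially stable with respect to $p$. (4) There exists a pair $P,Q\in\mathcal{S}^d_{+,E}$ satisfying $A^\top P+PA+Q=0$. (5) For any $Q\in\mathcal{S}^d_{+,E}$, there exists a unique $P\in\mathcal{S}^d_{+,E}$ satisfying $A^\top P+PA+Q=0$. Consequently, the smallest subspace $E$ for which any of these statements holds is $E=E_{A,\ge0}$.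
   Context: A seminorm on $\mathbb{R}^d$ is a function $p:\mathbb{R}^d\to[0,\infty)$ that is absolutely homogeneous and satisfies the triangle inequality; $\ker(p)=\{x:p(x)=0\}$. The ODE $\dot x=Ax$ is globally exponentially stable with respect to a seminorm $p$ if there exist constants $\alpha,\beta>0$ such that $p(x(t))\le \alpha\, p(x(0))e^{-\beta t}$ for all $t\ge 0$ and every initialization $x(0)\in\mathbb{R}^d$. $\mathcal{S}^d_{+,E}$ denotes the set of symmetric positive semi-definite $d\times d$ matrices whose kernel is exactly $E$. *)

theory Defs
  imports "HOL-Analysis.Analysis"
begin

text \<open>Seminorm on R^d: nonnegative, absolutely homogeneous, triangle inequality.\<close>
definition seminorm :: "(real^'n \<Rightarrow> real) \<Rightarrow> bool" where
  "seminorm p \<longleftrightarrow> (\<forall>x. 0 \<le> p x) \<and> (\<forall>c x. p (c *\<^sub>R x) = \<bar>c\<bar> * p x)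
     \<and> (\<forall>x y. p (x + y) \<le> p x + p y)"

definition seminorm_ker :: "(real^'n \<Rightarrow> real) \<Rightarrow> (real^'n) set" where
  "seminorm_ker p = {x. p x = 0}"

text \<open>Global exponential stability of x' = A x w.r.t. p: every solution on [0,oo)
  (i.e. for every initialization x(0)) satisfies the exponential bound.\<close>
definition ges_wrt :: "real^'n^'n \<Rightarrow> (real^'n \<Rightarrow> real) \<Rightarrow> bool" where
  "ges_wrt A p \<longleftrightarrow> (\<exists>\<alpha> \<beta>. \<alpha> > 0 \<and> \<beta> > 0 \<and>
     (\<forall>x :: real \<Rightarrow> real^'n.
        (\<forall>t\<ge>0. (x has_vector_derivative (A *v x t)) (at t within {0..})) \<longrightarrow>
        (\<forall>t\<ge>0. p (x t) \<le> \<alpha> * p (x 0) * exp (- \<beta> * t))))"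

text \<open>S^d_{+,E}: symmetric positive semidefinite matrices with kernel exactly E.\<close>
definition psd_ker :: "(real^'n) set \<Rightarrow> (real^'n^'n) set" where
  "psd_ker E = {P. transpose P = P \<and> (\<forall>x. 0 \<le> x \<bullet> (P *v x)) \<and> {x. P *v x = 0} = E}"

definition cmat :: "real^'n^'n \<Rightarrow> complex^'n^'n" where
  "cmat A = (\<chi> i j. complex_of_real (A $ i $ j))"

definition cvec :: "real^'n \<Rightarrow> complex^'n" where
  "cvec x = (\<chi> i. complex_of_real (x $ i))"

text \<open>Generalized eigenvector v (over C) of A for eigenvalue mu.\<close>
definition gen_eigvec :: "real^'n^'n \<Rightarrow> complex \<Rightarrow> complex^'n \<Rightarrow> bool" where
  "gen_eigvec A \<mu> v \<longleftrightarrow> v \<noteq> 0 \<and>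
     (\<exists>k::nat. ((\<lambda>w. cmat A *v w - \<mu> *s w) ^^ k) v = 0)"

text \<open>E_{A,>=0}: the real subspace spanned by the generalized eigenvectors of A
  for eigenvalues with nonnegative real part (real vectors in their complex span).\<close>
definition E_ge0 :: "real^'n^'n \<Rightarrow> (real^'n) set" where
  "E_ge0 A = {x. cvec x \<in> vec.span {v. \<exists>\<mu>. Re \<mu> \<ge> 0 \<and> gen_eigvec A \<mu> v}}"

text \<open>The five statements of the theorem, for a matrix A and a subspace E.\<close>
definition stmt1 :: "real^'n^'n \<Rightarrow> (real^'n) set \<Rightarrow> bool" where
  "stmt1 A E \<longleftrightarrow> (\<forall>x\<in>E. A *v x \<in> E) \<and> E_ge0 A \<subseteq> E"
definition stmt2 :: "real^'n^'n \<Rightarrow> (real^'n) set \<Rightarrow> bool" where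
  "stmt2 A E \<longleftrightarrow> (\<exists>p. seminorm p \<and> seminorm_ker p = E \<and> ges_wrt A p)"
definition stmt3 :: "real^'n^'n \<Rightarrow> (real^'n) set \<Rightarrow> bool" where
  "stmt3 A E \<longleftrightarrow> (\<forall>p. seminorm p \<and> seminorm_ker p = E \<longrightarrow> ges_wrt A p)"
definition stmt4 :: "real^'n^'n \<Rightarrow> (real^'n) set \<Rightarrow> bool" where
  "stmt4 A E \<longleftrightarrow> (\<exists>P Q. P \<in> psd_ker E \<and> Q \<in> psd_ker E \<and> transpose A ** P + P ** A + Q = 0)"
definition stmt5 :: "real^'n^'n \<Rightarrow> (real^'n) set \<Rightarrow> bool" where
  "stmt5 A E \<longleftrightarrow> (\<forall>Q\<in>psd_ker E. \<exists>!P. P \<in> psd_ker E \<and> transpose A ** P + P ** A + Q = 0)"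

end

theory Submission
  imports Defs "HOL-Computational_Algebra.Fundamental_Theorem_Algebra"
begin

text \<open>
  Over \<open>\<complex>\<close> the generalized eigenvectors of \<open>A\<close> span everything (fundamental theorem of
  algebra). Solutions starting at generalized eigenvectors with \<open>Re \<mu> < 0\<close> decay exponentially,
  those with \<open>Re \<mu> \<ge> 0\<close> stay in their span. So if \<open>E\<close> is \<open>A\<close>-invariant and contains
  \<open>E_ge0 A\<close>, the component of a solution orthogonal to \<open>E\<close> decays uniformly; by invariance it
  obeys an autonomous equation, and since every seminorm with kernel \<open>E\<close> is equivalent to the norm
  of that component, (1) gives (3). Conversely both (2) and (4) force every Jordan chain with
  \<open>Re \<mu> \<ge> 0\<close> into \<open>E\<close>, one step at a time: modulo \<open>E\<close> the solution through the next vector is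
  \<open>e\<^sup>\<mu>\<^sup>t v\<close>, which cannot decay, and the Lyapunov identity gives
  \<open>2 Re \<mu> (a\<bullet>Pa + b\<bullet>Pb) + a\<bullet>Qa + b\<bullet>Qb = 0\<close> for \<open>v = a + i b\<close>. For (5), the map
  \<open>P \<mapsto> A\<^sup>T P + P A\<close> is injective on symmetric matrices vanishing on \<open>E\<close>, because \<open>x\<^sup>T P x\<close> is
  constant along solutions when the image is zero yet tends to \<open>0\<close>; hence it is bijective, and the
  solution is positive semidefinite because \<open>x\<^sup>T P x\<close> is then nonincreasing and tends to \<open>0\<close>. The
  orthogonal projection onto \<open>E\<^sup>\<bottom>\<close> provides the seminorm in (2) and the matrix in (4).
\<close>

section \<open>Generalized eigenspaces\<close>

definition eig_shift :: "'a::field^'n^'n \<Rightarrow> 'a \<Rightarrow> 'a^'n \<Rightarrow> 'a^'n" where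
  "eig_shift B \<mu> w = B *v w - \<mu> *s w"

definition gen_eigenspace :: "'a::field^'n^'n \<Rightarrow> 'a \<Rightarrow> ('a^'n) set" where
  "gen_eigenspace B \<mu> = {v. \<exists>k. (eig_shift B \<mu> ^^ k) v = 0}"

definition gen_eigvecs :: "'a::field^'n^'n \<Rightarrow> ('a^'n) set" where
  "gen_eigvecs B = (\<Union>\<mu>. gen_eigenspace B \<mu>)"

lemma linear_eig_shift: "Vector_Spaces.linear (*s) (*s) (eig_shift B \<mu>)"
  unfolding eig_shift_def[abs_def]
  by (intro vec.linear_compose_sub matrix_vector_mul_linear_gen vec.linear_scale_self)

lemma linear_eig_shift_pow: "Vector_Spaces.linear (*s) (*s) (eig_shift B \<mu> ^^ k)"
proof (induction k)
  case 0
  show ?case using vec.linear_ident by (simp add: id_def)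
next
  case (Suc k)
  show ?case unfolding funpow.simps(2) by (rule Vector_Spaces.linear_compose[OF Suc linear_eig_shift])
qed

lemmas eig_shift_pow_add = vec.linear_add[OF linear_eig_shift_pow]
lemmas eig_shift_pow_scale = vec.linear_scale[OF linear_eig_shift_pow]
lemmas eig_shift_pow_0 [simp] = vec.linear_0[OF linear_eig_shift_pow]

lemma eig_shift_commute: "eig_shift B \<nu> (eig_shift B \<mu> w) = eig_shift B \<mu> (eig_shift B \<nu> w)"
  by (simp add: eig_shift_def vector_scalar_commute algebra_simps)

lemma eig_shift_pow_commute: "eig_shift B \<nu> ((eig_shift B \<mu> ^^ k) w) = (eig_shift B \<mu> ^^ k) (eig_shift B \<nu> w)"
  by (induction k) (auto simp: eig_shift_commute)

lemma eig_shift_change: "eig_shift B \<nu> w = eig_shift B \<mu> w + (\<mu> - \<nu>) *s w"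
  by (simp add: eig_shift_def algebra_simps)

lemma eig_shift_pow_eq_0_mono:
  assumes "(eig_shift B \<mu> ^^ k) v = 0" and "k \<le> m"
  shows "(eig_shift B \<mu> ^^ m) v = 0"
proof -
  obtain d where "m = d + k" using assms(2) by (metis le_add_diff_inverse2)
  then show ?thesis using assms(1) by (simp add: funpow_add)
qed

lemma gen_eigenspace_eig_shift_preimage:
  assumes "eig_shift B \<mu> v \<in> gen_eigenspace B \<mu>"
  shows "v \<in> gen_eigenspace B \<mu>"
proof -
  obtain k where "(eig_shift B \<mu> ^^ k) (eig_shift B \<mu> v) = 0"
    using assms by (auto simp: gen_eigenspace_def)
  then have "(eig_shift B \<mu> ^^ Suc k) v = 0" by (simp only: funpow_Suc_right o_apply)
  then show ?thesis unfolding gen_eigenspace_def by blast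
qed

lemma subspace_gen_eigenspace: "vec.subspace (gen_eigenspace B \<mu>)"
  unfolding vec.subspace_def
proof (intro conjI ballI allI)
  show "0 \<in> gen_eigenspace B \<mu>" by (auto simp: gen_eigenspace_def intro: exI[of _ 0])
next
  fix x y assume "x \<in> gen_eigenspace B \<mu>" "y \<in> gen_eigenspace B \<mu>"
  then obtain k l where "(eig_shift B \<mu> ^^ k) x = 0" "(eig_shift B \<mu> ^^ l) y = 0"
    by (auto simp: gen_eigenspace_def)
  then have "(eig_shift B \<mu> ^^ max k l) x = 0" "(eig_shift B \<mu> ^^ max k l) y = 0"
    by (auto intro: eig_shift_pow_eq_0_mono)
  then show "x + y \<in> gen_eigenspace B \<mu>"
    unfolding gen_eigenspace_def by (intro CollectI exI[of _ "max k l"]) (simp add: eig_shift_pow_add)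
next
  fix c x assume "x \<in> gen_eigenspace B \<mu>"
  then show "c *s x \<in> gen_eigenspace B \<mu>"
    by (auto simp: gen_eigenspace_def eig_shift_pow_scale)
qed

lemma eig_shift_in_gen_eigenspace:
  "v \<in> gen_eigenspace B \<mu> \<Longrightarrow> eig_shift B \<nu> v \<in> gen_eigenspace B \<mu>"
  unfolding gen_eigenspace_def
  by (auto simp flip: eig_shift_pow_commute) (metis vec.linear_0[OF linear_eig_shift])

lemma eig_shift_pow_in_gen_eigenspace:
  "v \<in> gen_eigenspace B \<mu> \<Longrightarrow> (eig_shift B \<nu> ^^ j) v \<in> gen_eigenspace B \<mu>"
  by (induction j) (auto simp: eig_shift_in_gen_eigenspace)

text \<open>On the generalized eigenspace of \<open>\<mu>\<close>, the map \<open>B - \<nu>\<close> is \<open>(\<mu> - \<nu>) + N\<close> with \<open>N\<close> nilpotent;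
  its inverse is the finite Neumann series \<open>\<Sum>\<^sub>j (-N)\<^sup>j / (\<mu> - \<nu>)\<^sup>j\<^sup>+\<^sup>1\<close>.\<close>
lemma eig_shift_onto_gen_eigenspace:
  assumes g: "g \<in> gen_eigenspace B \<mu>" and ne: "\<mu> \<noteq> \<nu>"
  shows "\<exists>h\<in>gen_eigenspace B \<mu>. eig_shift B \<nu> h = g"
proof -
  let ?N = "eig_shift B \<mu>"
  obtain K where K: "(?N ^^ K) g = 0" using g by (auto simp: gen_eigenspace_def)
  define c where "c = \<mu> - \<nu>"
  have c0: "c \<noteq> 0" using ne by (simp add: c_def)
  define T where "T j = ((-1)^j / c^j) *s (?N ^^ j) g" for j
  define h where "h = (\<Sum>j<K. ((-1)^j / c^(Suc j)) *s (?N ^^ j) g)"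
  have h_mem: "h \<in> gen_eigenspace B \<mu>"
    unfolding h_def
    by (intro vec.subspace_sum[OF subspace_gen_eigenspace] vec.subspace_scale[OF subspace_gen_eigenspace]
        eig_shift_pow_in_gen_eigenspace g)
  have telescoping: "eig_shift B \<nu> (((-1)^j / c^(Suc j)) *s (?N ^^ j) g) = T j - T (Suc j)" for j
  proof -
    have "eig_shift B \<nu> (((-1)^j / c^(Suc j)) *s (?N ^^ j) g)
        = ((-1)^j / c^(Suc j)) *s ((?N ^^ Suc j) g + c *s (?N ^^ j) g)"
      by (simp add: vec.linear_scale[OF linear_eig_shift] eig_shift_change[of B \<nu> _ \<mu>] c_def)
    also have "\<dots> = T j - T (Suc j)"
      using c0 by (simp add: T_def)
    finally show ?thesis .
  qed
  have "eig_shift B \<nu> h = (\<Sum>j<K. T j - T (Suc j))"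
    unfolding h_def vec.linear_sum[OF linear_eig_shift] telescoping by simp
  also have "\<dots> = T 0 - T K" by (rule sum_lessThan_telescope')
  also have "\<dots> = g" by (simp add: T_def K)
  finally show ?thesis using h_mem by blast
qed

lemma span_gen_eigvecs_subset:
  "vec.span (gen_eigvecs B) \<subseteq>
    {x + y |x y. x \<in> eig_shift B \<nu> ` vec.span (gen_eigvecs B) \<and> y \<in> gen_eigenspace B \<nu>}"
proof (rule vec.span_minimal)
  show "vec.subspace {x + y |x y. x \<in> eig_shift B \<nu> ` vec.span (gen_eigvecs B) \<and> y \<in> gen_eigenspace B \<nu>}"
    by (intro vec.subspace_sums vec.linear_subspace_image[OF linear_eig_shift] vec.subspace_span
        subspace_gen_eigenspace)
  show "gen_eigvecs B \<subseteq>
      {x + y |x y. x \<in> eig_shift B \<nu> ` vec.span (gen_eigvecs B) \<and> y \<in> gen_eigenspace B \<nu>}"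
  proof
    fix w assume "w \<in> gen_eigvecs B"
    then obtain \<mu> where w: "w \<in> gen_eigenspace B \<mu>" by (auto simp: gen_eigvecs_def)
    show "w \<in> {x + y |x y. x \<in> eig_shift B \<nu> ` vec.span (gen_eigvecs B) \<and> y \<in> gen_eigenspace B \<nu>}"
    proof (cases "\<mu> = \<nu>")
      case True
      have "w = eig_shift B \<nu> 0 + w" by (simp add: eig_shift_def)
      moreover have "eig_shift B \<nu> 0 \<in> eig_shift B \<nu> ` vec.span (gen_eigvecs B)"
        using vec.span_zero by (rule imageI)
      ultimately show ?thesis using w True by blast
    next
      case False
      then obtain h where h: "h \<in> gen_eigenspace B \<mu>" "eig_shift B \<nu> h = w"
        using eig_shift_onto_gen_eigenspace[OF w] by blast
      have "h \<in> vec.span (gen_eigvecs B)" using h(1) by (intro vec.span_base) (auto simp: gen_eigvecs_def)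
      then have "w \<in> eig_shift B \<nu> ` vec.span (gen_eigvecs B)" using h(2) by blast
      moreover have "w = w + 0" by simp
      ultimately show ?thesis using vec.subspace_0[OF subspace_gen_eigenspace[of B \<nu>]] by blast
    qed
  qed
qed

lemma span_gen_eigvecs_eig_shift_preimage:
  assumes "eig_shift B \<nu> v \<in> vec.span (gen_eigvecs B)"
  shows "v \<in> vec.span (gen_eigvecs B)"
proof -
  obtain h g where h: "h \<in> vec.span (gen_eigvecs B)" and g: "g \<in> gen_eigenspace B \<nu>"
    and eq: "eig_shift B \<nu> v = eig_shift B \<nu> h + g"
    using subsetD[OF span_gen_eigvecs_subset assms] by blast
  have "eig_shift B \<nu> (v - h) \<in> gen_eigenspace B \<nu>"
    using eq g by (simp add: vec.linear_diff[OF linear_eig_shift])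
  then have "v - h \<in> gen_eigenspace B \<nu>" by (rule gen_eigenspace_eig_shift_preimage)
  then have "v - h \<in> vec.span (gen_eigvecs B)" by (intro vec.span_base) (auto simp: gen_eigvecs_def)
  then have "(v - h) + h \<in> vec.span (gen_eigvecs B)" using h vec.span_add by blast
  then show ?thesis by simp
qed

definition poly_mat_mult :: "'a::field^'n^'n \<Rightarrow> 'a poly \<Rightarrow> 'a^'n \<Rightarrow> 'a^'n" where
  "poly_mat_mult B p v = (\<Sum>j\<le>degree p. coeff p j *s (((*v) B) ^^ j) v)"

lemma poly_mat_mult_degree_le:
  assumes "degree p \<le> n"
  shows "poly_mat_mult B p v = (\<Sum>j\<le>n. coeff p j *s (((*v) B) ^^ j) v)"
  unfolding poly_mat_mult_def
  by (rule sum.mono_neutral_left) (use assms in \<open>auto simp: coeff_eq_0\<close>)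

lemma poly_mat_mult_add: "poly_mat_mult B (p + q) v = poly_mat_mult B p v + poly_mat_mult B q v"
proof -
  let ?n = "max (degree p) (degree q)"
  have "degree (p + q) \<le> ?n" by (rule degree_add_le) auto
  then show ?thesis
    by (simp add: poly_mat_mult_degree_le[of _ ?n] sum.distrib)
qed

lemma poly_mat_mult_smult: "poly_mat_mult B (smult c p) v = c *s poly_mat_mult B p v"
  unfolding poly_mat_mult_degree_le[OF degree_smult_le] poly_mat_mult_def
  by (simp add: vec.scale_sum_right)

lemma poly_mat_mult_0 [simp]: "poly_mat_mult B 0 v = 0"
  by (simp add: poly_mat_mult_def)

lemma poly_mat_mult_diff: "poly_mat_mult B (p - q) v = poly_mat_mult B p v - poly_mat_mult B q v"
  using poly_mat_mult_add[of B "p - q" q v] by simp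

lemma poly_mat_mult_sum: "poly_mat_mult B (\<Sum>i\<in>S. f i) v = (\<Sum>i\<in>S. poly_mat_mult B (f i) v)"
  by (induction S rule: infinite_finite_induct) (auto simp: poly_mat_mult_add)

lemma poly_mat_mult_monom: "poly_mat_mult B (monom c j) v = c *s (((*v) B) ^^ j) v"
proof -
  have "poly_mat_mult B (monom c j) v = (\<Sum>i\<le>j. coeff (monom c j) i *s (((*v) B) ^^ i) v)"
    by (rule poly_mat_mult_degree_le[OF degree_monom_le])
  also have "\<dots> = (\<Sum>i\<le>j. (if j = i then c *s (((*v) B) ^^ i) v else 0))"
    by (rule sum.cong) auto
  finally show ?thesis by simp
qed

lemma poly_mat_mult_const: "poly_mat_mult B [:c:] v = c *s v"
  by (simp add: poly_mat_mult_def)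

lemma poly_mat_mult_pCons_0: "poly_mat_mult B (pCons 0 q) v = B *v poly_mat_mult B q v"
proof -
  have "poly_mat_mult B (pCons 0 q) v
      = (\<Sum>j\<le>Suc (degree q). coeff (pCons 0 q) j *s (((*v) B) ^^ j) v)"
    by (rule poly_mat_mult_degree_le[OF degree_pCons_le])
  also have "\<dots> = (\<Sum>j\<le>degree q. coeff q j *s (((*v) B) ^^ Suc j) v)"
    by (subst sum.atMost_Suc_shift) simp
  also have "\<dots> = B *v poly_mat_mult B q v"
    by (simp add: poly_mat_mult_def vec.sum vector_scalar_commute)
  finally show ?thesis .
qed

lemma poly_mat_mult_eig_shift: "poly_mat_mult B q (eig_shift B \<nu> v) = eig_shift B \<nu> (poly_mat_mult B q v)"
proof -
  have "B *v eig_shift B \<nu> w = eig_shift B \<nu> (B *v w)" for w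
    by (simp add: eig_shift_def matrix_vector_mult_diff_distrib vector_scalar_commute matrix_vector_mul_assoc)
  then have "(((*v) B) ^^ j) (eig_shift B \<nu> v) = eig_shift B \<nu> ((((*v) B) ^^ j) v)" for j
    by (induction j) auto
  then show ?thesis
    by (simp add: poly_mat_mult_def vec.linear_sum[OF linear_eig_shift] vec.linear_scale[OF linear_eig_shift])
qed

lemma poly_mat_mult_linear_factor:
  "poly_mat_mult B ([:-a, 1:] * q) v = poly_mat_mult B q (eig_shift B a v)"
proof -
  have "[:-a, 1:] * q = pCons 0 q - smult a q" by simp
  then have "poly_mat_mult B ([:-a, 1:] * q) v = B *v poly_mat_mult B q v - a *s poly_mat_mult B q v"
    by (simp only: poly_mat_mult_diff poly_mat_mult_smult poly_mat_mult_pCons_0)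
  also have "\<dots> = eig_shift B a (poly_mat_mult B q v)" by (simp add: eig_shift_def)
  finally show ?thesis by (simp add: poly_mat_mult_eig_shift)
qed

text \<open>The \<open>n + 1\<close> vectors \<open>B\<^sup>j v\<close>, \<open>j \<le> n\<close>, are linearly dependent.\<close>
lemma ex_annihilating_poly: "\<exists>p. p \<noteq> 0 \<and> poly_mat_mult B p (v :: 'a::field^'n) = 0"
proof (cases "inj_on (\<lambda>j. (((*v) B) ^^ j) v) {..CARD('n)}")
  case False
  then obtain i j where ij: "i \<noteq> j" "(((*v) B) ^^ i) v = (((*v) B) ^^ j) v"
    unfolding inj_on_def by blast
  let ?p = "monom 1 i - monom 1 j :: 'a poly"
  have "coeff ?p i = 1" using ij by simp
  then have "?p \<noteq> 0" by (metis coeff_0 zero_neq_one)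
  moreover have "poly_mat_mult B ?p v = 0" using ij by (simp add: poly_mat_mult_diff poly_mat_mult_monom)
  ultimately show ?thesis by blast
next
  case True
  let ?S = "(\<lambda>j. (((*v) B) ^^ j) v) ` {..CARD('n)}"
  have "vec.dependent ?S"
  proof (rule ccontr)
    assume "vec.independent ?S"
    then have "card ?S \<le> vec.dim ?S" using vec.independent_bound_general by blast
    also have "\<dots> \<le> vec.dim (UNIV :: ('a^'n) set)" by (rule vec.dim_subset) simp
    also have "\<dots> = CARD('n)" by (rule vec_dim_card)
    finally show False using True by (simp add: card_image)
  qed
  then obtain u where u: "\<exists>s\<in>?S. u s \<noteq> 0" "(\<Sum>s\<in>?S. u s *s s) = 0"
    using vec.dependent_finite[of ?S] by auto
  let ?p = "\<Sum>j\<le>CARD('n). monom (u ((((*v) B) ^^ j) v)) j"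
  obtain j0 where j0: "j0 \<le> CARD('n)" "u ((((*v) B) ^^ j0) v) \<noteq> 0" using u(1) by auto
  have "coeff ?p j0 = u ((((*v) B) ^^ j0) v)" using j0(1) by (rule coeff_sum_monom)
  then have "?p \<noteq> 0" using j0 by auto
  moreover have "poly_mat_mult B ?p v = (\<Sum>s\<in>?S. u s *s s)"
    using True by (simp add: poly_mat_mult_sum poly_mat_mult_monom sum.reindex)
  ultimately show ?thesis using u(2) by metis
qed

text \<open>Induction on the degree, splitting off a linear factor by the fundamental theorem of algebra.\<close>
lemma poly_mat_mult_eq_0_imp_span_gen_eigvecs:
  fixes B :: "complex^'n^'n"
  assumes "p \<noteq> 0" "poly_mat_mult B p v = 0"
  shows "v \<in> vec.span (gen_eigvecs B)"
  using assms
proof (induction "degree p" arbitrary: p v rule: less_induct)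
  case less
  show ?case
  proof (cases "degree p = 0")
    case True
    then obtain c where "p = [:c:]" by (rule degree_eq_zeroE)
    with less.prems have "v = 0" by (auto simp: poly_mat_mult_const)
    then show ?thesis by (simp add: vec.span_zero)
  next
    case False
    then obtain z where "poly p z = 0"
      using fundamental_theorem_of_algebra[of p] constant_degree[of p] by auto
    then obtain q where pq: "p = [:-z, 1:] * q" using poly_eq_0_iff_dvd by (metis dvdE)
    with less.prems(1) have q0: "q \<noteq> 0" by auto
    have "degree p = degree [:-z, 1:] + degree q" unfolding pq using q0 by (intro degree_mult_eq) auto
    then have "degree q < degree p" by simp
    moreover have "poly_mat_mult B q (eig_shift B z v) = 0"
      using less.prems(2) unfolding pq poly_mat_mult_linear_factor .
    ultimately have "eig_shift B z v \<in> vec.span (gen_eigvecs B)" using less.hyps q0 by blast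
    then show ?thesis by (rule span_gen_eigvecs_eig_shift_preimage)
  qed
qed

lemma span_gen_eigvecs_UNIV: "v \<in> vec.span (gen_eigvecs (B :: complex^'n^'n))"
  using ex_annihilating_poly[of B v] poly_mat_mult_eq_0_imp_span_gen_eigvecs by blast

section \<open>Real and imaginary parts\<close>

definition Re_vec :: "complex^'n \<Rightarrow> real^'n" where "Re_vec z = (\<chi> i. Re (z$i))"
definition Im_vec :: "complex^'n \<Rightarrow> real^'n" where "Im_vec z = (\<chi> i. Im (z$i))"
definition cnj_vec :: "complex^'n \<Rightarrow> complex^'n" where "cnj_vec z = (\<chi> i. cnj (z$i))"

lemma Re_vec_cvec [simp]: "Re_vec (cvec x) = x" by (simp add: Re_vec_def cvec_def)
lemma Re_vec_0 [simp]: "Re_vec 0 = 0" by (simp add: Re_vec_def vec_eq_iff)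
lemma Im_vec_0 [simp]: "Im_vec 0 = 0" by (simp add: Im_vec_def vec_eq_iff)
lemma Re_vec_add: "Re_vec (z + w) = Re_vec z + Re_vec w" by (simp add: Re_vec_def vec_eq_iff)
lemma Im_vec_add: "Im_vec (z + w) = Im_vec z + Im_vec w" by (simp add: Im_vec_def vec_eq_iff)
lemma Re_vec_diff: "Re_vec (z - w) = Re_vec z - Re_vec w" by (simp add: Re_vec_def vec_eq_iff)
lemma Im_vec_diff: "Im_vec (z - w) = Im_vec z - Im_vec w" by (simp add: Im_vec_def vec_eq_iff)
lemma Re_vec_scaleR: "Re_vec (r *\<^sub>R z) = r *\<^sub>R Re_vec z" by (simp add: Re_vec_def vec_eq_iff)
lemma Im_vec_scaleR: "Im_vec (r *\<^sub>R z) = r *\<^sub>R Im_vec z" by (simp add: Im_vec_def vec_eq_iff)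
lemma Re_vec_smult: "Re_vec (c *s z) = Re c *\<^sub>R Re_vec z - Im c *\<^sub>R Im_vec z"
  by (simp add: Re_vec_def Im_vec_def vec_eq_iff)
lemma Im_vec_smult: "Im_vec (c *s z) = Im c *\<^sub>R Re_vec z + Re c *\<^sub>R Im_vec z"
  by (simp add: Re_vec_def Im_vec_def vec_eq_iff)
lemma Re_vec_mult: "Re_vec (cmat A *v z) = A *v Re_vec z"
  by (simp add: Re_vec_def cmat_def matrix_vector_mult_def vec_eq_iff)
lemma Im_vec_mult: "Im_vec (cmat A *v z) = A *v Im_vec z"
  by (simp add: Im_vec_def cmat_def matrix_vector_mult_def vec_eq_iff)

lemma cvec_add: "cvec (x + y) = cvec x + cvec y" by (simp add: cvec_def vec_eq_iff)
lemma cvec_scaleR: "cvec (r *\<^sub>R x) = of_real r *s cvec x" by (simp add: cvec_def vec_eq_iff)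
lemma cvec_0 [simp]: "cvec 0 = 0" by (simp add: cvec_def vec_eq_iff)
lemma cmat_mult_cvec: "cmat A *v cvec x = cvec (A *v x)"
  by (simp add: cvec_def cmat_def matrix_vector_mult_def vec_eq_iff)

lemma cnj_vec_add: "cnj_vec (z + w) = cnj_vec z + cnj_vec w" by (simp add: cnj_vec_def vec_eq_iff)
lemma cnj_vec_diff: "cnj_vec (z - w) = cnj_vec z - cnj_vec w" by (simp add: cnj_vec_def vec_eq_iff)
lemma cnj_vec_smult: "cnj_vec (c *s z) = cnj c *s cnj_vec z" by (simp add: cnj_vec_def vec_eq_iff)
lemma cnj_vec_mult: "cnj_vec (cmat A *v z) = cmat A *v cnj_vec z"
  by (simp add: cnj_vec_def cmat_def matrix_vector_mult_def vec_eq_iff)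
lemma cnj_vec_0 [simp]: "cnj_vec 0 = 0" by (simp add: cnj_vec_def vec_eq_iff)
lemma cnj_vec_eq_0_iff [simp]: "cnj_vec z = 0 \<longleftrightarrow> z = 0" by (simp add: cnj_vec_def vec_eq_iff)

lemma cvec_Re_vec: "cvec (Re_vec z) = (1/2) *s (z + cnj_vec z)"
  by (simp add: cvec_def Re_vec_def cnj_vec_def vec_eq_iff complex_eq_iff)

lemma bounded_linear_Re_vec: "bounded_linear Re_vec"
  unfolding linear_conv_bounded_linear[symmetric]
  by (rule linearI) (simp_all add: Re_vec_add Re_vec_scaleR)
lemma bounded_linear_Im_vec: "bounded_linear Im_vec"
  unfolding linear_conv_bounded_linear[symmetric]
  by (rule linearI) (simp_all add: Im_vec_add Im_vec_scaleR)

lemma scaleR_eq_smult: "r *\<^sub>R (z :: complex^'n) = complex_of_real r *s z"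
  unfolding vec_eq_iff
proof
  fix i show "(r *\<^sub>R z) $ i = (complex_of_real r *s z) $ i"
    by (simp only: vector_scaleR_component vector_smult_component) (simp add: scaleR_conv_of_real)
qed

lemma norm_smult: "norm (c *s (z :: complex^'n)) = cmod c * norm z"
  unfolding norm_vec_def by (simp add: L2_set_right_distrib norm_mult)

lemma bounded_bilinear_smult: "bounded_bilinear (\<lambda>(a::complex) (z::complex^'n). a *s z)"
proof (rule bounded_bilinear.intro)
  show "\<exists>K. \<forall>a (z::complex^'n). norm (a *s z) \<le> norm a * norm z * K"
    by (rule exI[of _ 1]) (simp add: norm_smult)
qed (auto simp: scaleR_eq_smult scaleR_conv_of_real mult.commute)

section \<open>The subspace \<open>E_ge0 A\<close>\<close>

definition gen_eigvecs_ge0 :: "real^'n^'n \<Rightarrow> (complex^'n) set" where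
  "gen_eigvecs_ge0 A = {v. \<exists>\<mu>. Re \<mu> \<ge> 0 \<and> gen_eigvec A \<mu> v}"

definition gen_eigvecs_lt0 :: "real^'n^'n \<Rightarrow> (complex^'n) set" where
  "gen_eigvecs_lt0 A = {v. \<exists>\<mu>. Re \<mu> < 0 \<and> gen_eigvec A \<mu> v}"

lemma gen_eigvec_iff: "gen_eigvec A \<mu> v \<longleftrightarrow> v \<noteq> 0 \<and> v \<in> gen_eigenspace (cmat A) \<mu>"
proof -
  have "(\<lambda>w. cmat A *v w - \<mu> *s w) = eig_shift (cmat A) \<mu>" by (rule ext) (simp add: eig_shift_def)
  then show ?thesis by (simp add: gen_eigvec_def gen_eigenspace_def)
qed

lemma gen_eigenspace_subset_span_ge0:
  assumes "Re \<mu> \<ge> 0"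
  shows "gen_eigenspace (cmat A) \<mu> \<subseteq> vec.span (gen_eigvecs_ge0 A)"
proof
  fix x assume "x \<in> gen_eigenspace (cmat A) \<mu>"
  then show "x \<in> vec.span (gen_eigvecs_ge0 A)" using assms
    by (cases "x = 0") (auto simp: gen_eigvecs_ge0_def gen_eigvec_iff vec.span_zero intro!: vec.span_base)
qed

lemma E_ge0_eq: "E_ge0 A = {x. cvec x \<in> vec.span (gen_eigvecs_ge0 A)}"
  by (simp add: E_ge0_def gen_eigvecs_ge0_def)

lemma eig_shift_cnj_vec: "eig_shift (cmat A) (cnj \<mu>) (cnj_vec v) = cnj_vec (eig_shift (cmat A) \<mu> v)"
  by (simp add: eig_shift_def cnj_vec_diff cnj_vec_mult cnj_vec_smult)

lemma cnj_vec_in_gen_eigenspace: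
  assumes "v \<in> gen_eigenspace (cmat A) \<mu>"
  shows "cnj_vec v \<in> gen_eigenspace (cmat A) (cnj \<mu>)"
proof -
  have "(eig_shift (cmat A) (cnj \<mu>) ^^ k) (cnj_vec v) = cnj_vec ((eig_shift (cmat A) \<mu> ^^ k) v)" for k
    by (induction k) (auto simp: eig_shift_cnj_vec)
  then show ?thesis using assms by (auto simp: gen_eigenspace_def)
qed

lemma cnj_vec_in_span_ge0:
  assumes "z \<in> vec.span (gen_eigvecs_ge0 A)"
  shows "cnj_vec z \<in> vec.span (gen_eigvecs_ge0 A)"
  using assms
proof (induction rule: vec.span_induct_alt)
  case base
  show ?case by (simp add: vec.span_zero)
next
  case (step c x y)
  from step(1) obtain \<mu> where "Re \<mu> \<ge> 0" "x \<noteq> 0" "x \<in> gen_eigenspace (cmat A) \<mu>"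
    unfolding gen_eigvecs_ge0_def gen_eigvec_iff by blast
  then have "cnj_vec x \<in> gen_eigvecs_ge0 A"
    unfolding gen_eigvecs_ge0_def gen_eigvec_iff
    by (intro CollectI exI[of _ "cnj \<mu>"]) (auto intro: cnj_vec_in_gen_eigenspace)
  then show ?case using step(2)
    by (simp add: cnj_vec_add cnj_vec_smult vec.span_add vec.span_scale vec.span_base)
qed

lemma Re_vec_in_E_ge0: "z \<in> vec.span (gen_eigvecs_ge0 A) \<Longrightarrow> Re_vec z \<in> E_ge0 A"
  unfolding E_ge0_eq using cnj_vec_in_span_ge0
  by (auto simp: cvec_Re_vec intro!: vec.span_scale vec.span_add)

lemma subspace_E_ge0: "subspace (E_ge0 A)"
  unfolding subspace_def E_ge0_eq
  by (auto simp: cvec_add cvec_scaleR vec.span_zero intro!: vec.span_add vec.span_scale)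

lemma cmat_mult_span_ge0:
  assumes "z \<in> vec.span (gen_eigvecs_ge0 A)"
  shows "cmat A *v z \<in> vec.span (gen_eigvecs_ge0 A)"
  using assms
proof (induction rule: vec.span_induct_alt)
  case base
  show ?case by (simp add: vec.span_zero)
next
  case (step c x y)
  obtain \<mu> where \<mu>: "Re \<mu> \<ge> 0" "x \<in> gen_eigenspace (cmat A) \<mu>"
    using step(1) unfolding gen_eigvecs_ge0_def gen_eigvec_iff by blast
  have "eig_shift (cmat A) \<mu> x \<in> vec.span (gen_eigvecs_ge0 A)"
    using gen_eigenspace_subset_span_ge0[OF \<mu>(1)] eig_shift_in_gen_eigenspace[OF \<mu>(2)] by blast
  moreover have "x \<in> vec.span (gen_eigvecs_ge0 A)" using step(1) by (rule vec.span_base)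
  moreover have "cmat A *v (c *s x + y) = c *s (eig_shift (cmat A) \<mu> x + \<mu> *s x) + cmat A *v y"
    by (simp add: eig_shift_def matrix_vector_right_distrib vector_scalar_commute)
  ultimately show ?case using step(2) by (metis vec.span_add vec.span_scale)
qed

lemma E_ge0_invariant: "x \<in> E_ge0 A \<Longrightarrow> A *v x \<in> E_ge0 A"
  unfolding E_ge0_eq by (auto simp flip: cmat_mult_cvec intro: cmat_mult_span_ge0)

lemma span_ge0_lt0_decomp:
  "\<exists>u w. v = u + w \<and> u \<in> vec.span (gen_eigvecs_ge0 A) \<and> w \<in> vec.span (gen_eigvecs_lt0 A)"
proof -
  have "gen_eigvecs (cmat A) \<subseteq> vec.span (gen_eigvecs_ge0 A \<union> gen_eigvecs_lt0 A)"
  proof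
    fix v assume "v \<in> gen_eigvecs (cmat A)"
    then obtain \<mu> where "v \<in> gen_eigenspace (cmat A) \<mu>" by (auto simp: gen_eigvecs_def)
    then show "v \<in> vec.span (gen_eigvecs_ge0 A \<union> gen_eigvecs_lt0 A)"
      by (cases "v = 0"; cases "Re \<mu> \<ge> 0")
        (auto simp: vec.span_zero gen_eigvecs_ge0_def gen_eigvecs_lt0_def gen_eigvec_iff intro!: vec.span_base)
  qed
  then have "vec.span (gen_eigvecs (cmat A)) \<subseteq> vec.span (gen_eigvecs_ge0 A \<union> gen_eigvecs_lt0 A)"
    by (simp add: vec.span_minimal)
  then have "v \<in> vec.span (gen_eigvecs_ge0 A \<union> gen_eigvecs_lt0 A)"
    using span_gen_eigvecs_UNIV by blast
  then show ?thesis unfolding vec.span_Un by blast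
qed

section \<open>Solutions of the linear ODE\<close>

definition solution :: "real^'n^'n \<Rightarrow> (real \<Rightarrow> real^'n) \<Rightarrow> bool" where
  "solution A x \<longleftrightarrow> (\<forall>t. (x has_vector_derivative (A *v x t)) (at t))"

definition csolution :: "real^'n^'n \<Rightarrow> (real \<Rightarrow> complex^'n) \<Rightarrow> bool" where
  "csolution A Y \<longleftrightarrow> (\<forall>t. (Y has_vector_derivative (cmat A *v Y t)) (at t))"

lemma solution_add: "solution A x \<Longrightarrow> solution A y \<Longrightarrow> solution A (\<lambda>t. x t + y t)"
  unfolding solution_def
  by (auto intro!: has_vector_derivative_add[THEN has_vector_derivative_eq_rhs]
      simp: matrix_vector_right_distrib)

lemma solution_scaleR: "solution A x \<Longrightarrow> solution A (\<lambda>t. c *\<^sub>R x t)"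
  unfolding solution_def
  by (auto intro!: bounded_linear.has_vector_derivative[OF bounded_linear_scaleR_right,
        THEN has_vector_derivative_eq_rhs] simp: matrix_vector_mult_scaleR)

lemma solution_sum: "(\<And>i. i \<in> S \<Longrightarrow> solution A (X i)) \<Longrightarrow> solution A (\<lambda>t. \<Sum>i\<in>S. X i t)"
proof (induction S rule: infinite_finite_induct)
  case (insert i F)
  then show ?case by (simp add: solution_add)
qed (simp_all add: solution_def)

lemma csolution_0: "csolution A (\<lambda>t. 0)"
  unfolding csolution_def by simp

lemma csolution_add: "csolution A Y \<Longrightarrow> csolution A Z \<Longrightarrow> csolution A (\<lambda>t. Y t + Z t)"
  unfolding csolution_def
  by (auto intro!: has_vector_derivative_add[THEN has_vector_derivative_eq_rhs]
      simp: matrix_vector_right_distrib)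

lemma csolution_smult: "csolution A Y \<Longrightarrow> csolution A (\<lambda>t. c *s Y t)"
  unfolding csolution_def
  by (auto intro!: bounded_bilinear.has_vector_derivative[OF bounded_bilinear_smult,
        THEN has_vector_derivative_eq_rhs] simp: vector_scalar_commute)

lemma solution_Re_vec: "csolution A Y \<Longrightarrow> solution A (\<lambda>t. Re_vec (Y t))"
  unfolding csolution_def solution_def
  by (auto intro!: bounded_linear.has_vector_derivative[OF bounded_linear_Re_vec,
        THEN has_vector_derivative_eq_rhs] simp: Re_vec_mult)

lemma solution_Im_vec: "csolution A Y \<Longrightarrow> solution A (\<lambda>t. Im_vec (Y t))"
  unfolding csolution_def solution_def
  by (auto intro!: bounded_linear.has_vector_derivative[OF bounded_linear_Im_vec,
        THEN has_vector_derivative_eq_rhs] simp: Im_vec_mult)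

lemma solution_within: "solution A x \<Longrightarrow> (x has_vector_derivative A *v x t) (at t within S)"
  unfolding solution_def by (blast intro: has_vector_derivative_at_within)

text \<open>\<open>nilp_exp A \<mu> v k t = \<Sum>\<^sub>j\<^sub><\<^sub>k t\<^sup>j/j! (A - \<mu>)\<^sup>j v\<close>; for \<open>v\<close> killed by \<open>(A - \<mu>)\<^sup>k\<close> this is \<open>exp (t (A - \<mu>)) v\<close>.\<close>
definition nilp_exp :: "real^'n^'n \<Rightarrow> complex \<Rightarrow> complex^'n \<Rightarrow> nat \<Rightarrow> real \<Rightarrow> complex^'n" where
  "nilp_exp A \<mu> v k t = (\<Sum>j<k. (t^j / fact j) *\<^sub>R (eig_shift (cmat A) \<mu> ^^ j) v)"

definition gen_eig_sol :: "real^'n^'n \<Rightarrow> complex \<Rightarrow> complex^'n \<Rightarrow> nat \<Rightarrow> real \<Rightarrow> complex^'n" where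
  "gen_eig_sol A \<mu> v k t = exp (\<mu> * of_real t) *s nilp_exp A \<mu> v k t"

lemma has_vector_derivative_nilp_exp:
  "(nilp_exp A \<mu> v (Suc k) has_vector_derivative nilp_exp A \<mu> (eig_shift (cmat A) \<mu> v) k t) (at t)"
proof (induction k)
  case 0
  show ?case by (simp add: nilp_exp_def[abs_def])
next
  case (Suc k)
  let ?N = "eig_shift (cmat A) \<mu>"
  have "((\<lambda>t. t^(Suc k) / fact (Suc k)) has_real_derivative
      (real (Suc k) * t^(Suc k - Suc 0) / fact (Suc k))) (at t)"
    by (rule DERIV_cdivide[OF DERIV_pow])
  moreover have "real (Suc k) * t^(Suc k - Suc 0) / fact (Suc k) = t^k / fact k"
    by (simp del: of_nat_Suc)
  ultimately have "((\<lambda>t. t^(Suc k) / fact (Suc k)) has_real_derivative (t^k / fact k)) (at t)"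
    by simp
  from has_vector_derivative_add[OF Suc has_vector_derivative_scaleR[OF this has_vector_derivative_const]]
  have "((\<lambda>t. nilp_exp A \<mu> v (Suc k) t + (t^(Suc k) / fact (Suc k)) *\<^sub>R (?N ^^ Suc k) v)
        has_vector_derivative (nilp_exp A \<mu> (?N v) k t + (t^k / fact k) *\<^sub>R (?N ^^ Suc k) v)) (at t)"
    by simp
  then show ?case
    by (simp add: nilp_exp_def[abs_def] funpow_Suc_right del: funpow.simps)
qed

lemma eig_shift_nilp_exp:
  "eig_shift (cmat A) \<mu> (nilp_exp A \<mu> v k t) = nilp_exp A \<mu> (eig_shift (cmat A) \<mu> v) k t"
  by (simp add: nilp_exp_def vec.linear_sum[OF linear_eig_shift] scaleR_eq_smult
      vec.linear_scale[OF linear_eig_shift] eig_shift_pow_commute)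

lemma nilp_exp_at_0: "nilp_exp A \<mu> v (Suc k) 0 = v"
proof -
  have "nilp_exp A \<mu> v (Suc k) 0 = (\<Sum>j<Suc k. if j = 0 then v else 0)"
    unfolding nilp_exp_def by (rule sum.cong) auto
  then show ?thesis by simp
qed

lemma gen_eig_sol_at_0:
  assumes "(eig_shift (cmat A) \<mu> ^^ k) v = 0"
  shows "gen_eig_sol A \<mu> v k 0 = v"
proof (cases k)
  case 0
  then show ?thesis using assms by (simp add: gen_eig_sol_def nilp_exp_def)
next
  case (Suc m)
  then show ?thesis by (simp add: gen_eig_sol_def nilp_exp_at_0)
qed

lemma csolution_gen_eig_sol:
  assumes "(eig_shift (cmat A) \<mu> ^^ k) v = 0"
  shows "csolution A (gen_eig_sol A \<mu> v k)"
  unfolding csolution_def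
proof
  fix t
  let ?e = "exp (\<mu> * of_real t)" and ?W = "nilp_exp A \<mu> v k t"
  have "nilp_exp A \<mu> v (Suc k) = nilp_exp A \<mu> v k"
    using assms by (simp add: nilp_exp_def[abs_def])
  then have W: "(nilp_exp A \<mu> v k has_vector_derivative eig_shift (cmat A) \<mu> ?W) (at t)"
    using has_vector_derivative_nilp_exp[of A \<mu> v k t] by (simp add: eig_shift_nilp_exp)
  have e: "((\<lambda>t. exp (\<mu> * of_real t)) has_vector_derivative \<mu> * ?e) (at t)"
    by (rule has_vector_derivative_real_field) (auto intro!: derivative_eq_intros)
  have "(gen_eig_sol A \<mu> v k has_vector_derivative
      ?e *s eig_shift (cmat A) \<mu> ?W + (\<mu> * ?e) *s ?W) (at t)"
    unfolding gen_eig_sol_def[abs_def]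
    using bounded_bilinear.has_vector_derivative[OF bounded_bilinear_smult e W] by simp
  moreover have "?e *s eig_shift (cmat A) \<mu> ?W + (\<mu> * ?e) *s ?W = cmat A *v gen_eig_sol A \<mu> v k t"
    by (simp add: gen_eig_sol_def eig_shift_def vector_scalar_commute mult.commute)
  ultimately show "(gen_eig_sol A \<mu> v k has_vector_derivative cmat A *v gen_eig_sol A \<mu> v k t) (at t)"
    by simp
qed

section \<open>Exponential decay\<close>

definition exp_decaying :: "(real \<Rightarrow> 'a::real_normed_vector) \<Rightarrow> bool" where
  "exp_decaying f \<longleftrightarrow> (\<exists>M \<beta>. \<beta> > 0 \<and> (\<forall>t\<ge>0. norm (f t) \<le> M * exp (-\<beta> * t)))"

lemma exp_decaying_0: "exp_decaying (\<lambda>t. 0)"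
  unfolding exp_decaying_def by (intro exI[of _ 0] exI[of _ 1]) simp

lemma exp_decay_mono:
  fixes M :: real
  assumes "\<beta> \<le> \<beta>'" and "0 \<le> t"
  shows "M * exp (-\<beta>' * t) \<le> \<bar>M\<bar> * exp (-\<beta> * t)"
proof -
  have "exp (-\<beta>' * t) \<le> exp (-\<beta> * t)" using assms by (simp add: mult_right_mono)
  then show ?thesis by (meson abs_ge_self abs_ge_zero exp_ge_zero mult_mono order_trans)
qed

lemma exp_decay_eventually_less:
  fixes M \<beta> a :: real
  assumes "0 < a" and "0 < \<beta>"
  shows "\<exists>t\<ge>0. M * exp (-\<beta> * t) < a"
proof -
  have "((\<lambda>t. M * exp (-\<beta> * t)) \<longlongrightarrow> M * 0) at_top"
    by (intro tendsto_mult tendsto_const filterlim_compose[OF exp_at_bot]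
        filterlim_tendsto_neg_mult_at_bot[OF tendsto_const _ filterlim_ident]) (use assms in auto)
  then have "eventually (\<lambda>t. M * exp (-\<beta> * t) < a \<and> t \<ge> 0) at_top"
    using assms by (auto intro!: eventually_conj order_tendstoD(2) eventually_ge_at_top)
  then show ?thesis by (auto dest: eventually_happens)
qed

lemma exp_decaying_add:
  assumes "exp_decaying f" and "exp_decaying g"
  shows "exp_decaying (\<lambda>t. f t + g t)"
proof -
  obtain Mf \<beta>f Mg \<beta>g where "\<beta>f > 0" "\<forall>t\<ge>0. norm (f t) \<le> Mf * exp (-\<beta>f * t)"
    and "\<beta>g > 0" "\<forall>t\<ge>0. norm (g t) \<le> Mg * exp (-\<beta>g * t)"
    using assms unfolding exp_decaying_def by blast
  moreover define \<beta> where "\<beta> = min \<beta>f \<beta>g"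
  ultimately have "norm (f t + g t) \<le> (\<bar>Mf\<bar> + \<bar>Mg\<bar>) * exp (-\<beta> * t)" if "t \<ge> 0" for t
    using that norm_triangle_ineq[of "f t" "g t"]
      exp_decay_mono[of \<beta> \<beta>f t Mf] exp_decay_mono[of \<beta> \<beta>g t Mg]
    by (fastforce simp: distrib_right)
  moreover have "\<beta> > 0" using \<open>\<beta>f > 0\<close> \<open>\<beta>g > 0\<close> by (simp add: \<beta>_def)
  ultimately show ?thesis unfolding exp_decaying_def by blast
qed

lemma exp_decaying_bounded_linear:
  assumes L: "bounded_linear L" and f: "exp_decaying f"
  shows "exp_decaying (\<lambda>t. L (f t))"
proof -
  obtain K where K: "\<And>x. norm (L x) \<le> norm x * K" "K > 0"
    using bounded_linear.pos_bounded[OF L] by blast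
  obtain M \<beta> where "\<beta> > 0" and M: "\<forall>t\<ge>0. norm (f t) \<le> M * exp (-\<beta> * t)"
    using f unfolding exp_decaying_def by blast
  moreover have "norm (L (f t)) \<le> (M * K) * exp (-\<beta> * t)" if "t \<ge> 0" for t
    using order_trans[OF K(1) mult_right_mono[OF M[rule_format, OF that] less_imp_le[OF K(2)]]]
    by (simp add: mult_ac)
  ultimately show ?thesis unfolding exp_decaying_def by blast
qed

lemma exp_decaying_nonneg:
  fixes f :: "real \<Rightarrow> real"
  assumes dec: "exp_decaying f" and le: "\<And>t. t \<ge> 0 \<Longrightarrow> f t \<le> f 0"
  shows "0 \<le> f 0"
proof (rule ccontr)
  assume "\<not> 0 \<le> f 0"
  then have "- f 0 > 0" by simp
  obtain M \<beta> where "\<beta> > 0" and M: "\<forall>t\<ge>0. norm (f t) \<le> M * exp (-\<beta> * t)"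
    using dec unfolding exp_decaying_def by blast
  then obtain t where t: "t \<ge> 0" "M * exp (-\<beta> * t) < - f 0"
    using exp_decay_eventually_less[OF \<open>- f 0 > 0\<close>] by blast
  have "- f 0 \<le> norm (f t)" using le[OF t(1)] abs_ge_minus_self[of "f t"] by simp
  then show False using M[rule_format, OF t(1)] t(2) by linarith
qed

lemma exp_decaying_const:
  fixes c :: real
  assumes "exp_decaying (\<lambda>t. c)"
  shows "c = 0"
proof -
  have "exp_decaying (\<lambda>t. - c)"
    using exp_decaying_bounded_linear[OF bounded_linear_minus[OF bounded_linear_ident] assms] .
  from exp_decaying_nonneg[OF this] exp_decaying_nonneg[OF assms] show ?thesis by simp
qed

lemma power_div_fact_le_exp: "(0::real) \<le> x \<Longrightarrow> x^n / fact n \<le> exp x"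
proof -
  assume x: "0 \<le> x"
  have "(\<Sum>i\<in>{n}. x^i /\<^sub>R fact i) \<le> (\<Sum>i. x^i /\<^sub>R fact i)"
    by (rule sum_le_suminf[OF summable_exp_generic]) (use x in auto)
  then show ?thesis by (simp add: exp_def divide_inverse_commute mult.commute)
qed

text \<open>The polynomial factor \<open>nilp_exp\<close> is absorbed by half of the decay rate \<open>- Re \<mu>\<close>.\<close>
lemma exp_decaying_gen_eig_sol:
  assumes "Re \<mu> < 0"
  shows "exp_decaying (gen_eig_sol A \<mu> v k)"
proof -
  define \<gamma> where "\<gamma> = - Re \<mu> / 2"
  have \<gamma>: "\<gamma> > 0" using assms by (simp add: \<gamma>_def)
  define M where "M = (\<Sum>j<k. norm ((eig_shift (cmat A) \<mu> ^^ j) v) / \<gamma>^j)"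
  have "norm (gen_eig_sol A \<mu> v k t) \<le> M * exp (-\<gamma> * t)" if t: "t \<ge> 0" for t
  proof -
    have tj: "t^j / fact j \<le> exp (\<gamma> * t) / \<gamma>^j" for j
    proof -
      have "(\<gamma> * t)^j / fact j \<le> exp (\<gamma> * t)" using \<gamma> t by (intro power_div_fact_le_exp) simp
      then show ?thesis using \<gamma> by (simp add: field_simps)
    qed
    have "norm (nilp_exp A \<mu> v k t) \<le> (\<Sum>j<k. (t^j / fact j) * norm ((eig_shift (cmat A) \<mu> ^^ j) v))"
      unfolding nilp_exp_def using norm_sum t by (fastforce intro: order_trans)
    also have "\<dots> \<le> (\<Sum>j<k. (exp (\<gamma> * t) / \<gamma>^j) * norm ((eig_shift (cmat A) \<mu> ^^ j) v))"
      by (intro sum_mono mult_right_mono tj) simp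
    also have "\<dots> = exp (\<gamma> * t) * M"
      by (simp add: M_def sum_distrib_left)
    finally have "exp (Re \<mu> * t) * norm (nilp_exp A \<mu> v k t) \<le> exp (Re \<mu> * t) * (exp (\<gamma> * t) * M)"
      by simp
    also have "\<dots> = M * exp (-\<gamma> * t)"
      by (simp add: \<gamma>_def mult_exp_exp algebra_simps)
    finally show ?thesis by (simp add: gen_eig_sol_def norm_smult)
  qed
  then show ?thesis using \<gamma> unfolding exp_decaying_def by blast
qed

lemma decaying_csolution_from_span_lt0:
  assumes "w \<in> vec.span (gen_eigvecs_lt0 A)"
  shows "\<exists>Y. csolution A Y \<and> Y 0 = w \<and> exp_decaying Y"
  using assms
proof (induction rule: vec.span_induct_alt)
  case base
  show ?case using csolution_0 exp_decaying_0 by blast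
next
  case (step c x y)
  then obtain Yy where Yy: "csolution A Yy" "Yy 0 = y" "exp_decaying Yy" by blast
  obtain \<mu> k where \<mu>: "Re \<mu> < 0" "(eig_shift (cmat A) \<mu> ^^ k) x = 0"
    using step(1) unfolding gen_eigvecs_lt0_def gen_eigvec_iff gen_eigenspace_def by blast
  define Y where "Y t = c *s gen_eig_sol A \<mu> x k t + Yy t" for t
  have "csolution A Y"
    unfolding Y_def[abs_def] by (intro csolution_add csolution_smult csolution_gen_eig_sol \<mu>(2) Yy(1))
  moreover have "Y 0 = c *s x + y"
    by (simp add: Y_def gen_eig_sol_at_0[OF \<mu>(2)] Yy(2))
  moreover have "exp_decaying Y"
    unfolding Y_def[abs_def] using Yy(3) exp_decaying_gen_eig_sol[OF \<mu>(1)]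
    by (intro exp_decaying_add exp_decaying_bounded_linear[where L = "(*s) c"]
        bounded_bilinear.bounded_linear_right[OF bounded_bilinear_smult])
  ultimately show ?case by blast
qed

lemma gen_eig_sol_in_span_ge0:
  assumes "Re \<mu> \<ge> 0" and "x \<in> gen_eigenspace (cmat A) \<mu>"
  shows "gen_eig_sol A \<mu> x k t \<in> vec.span (gen_eigvecs_ge0 A)"
proof -
  have "(eig_shift (cmat A) \<mu> ^^ j) x \<in> vec.span (gen_eigvecs_ge0 A)" for j
    using gen_eigenspace_subset_span_ge0[OF assms(1)] eig_shift_pow_in_gen_eigenspace[OF assms(2)]
    by blast
  then show ?thesis
    unfolding gen_eig_sol_def nilp_exp_def
    by (intro vec.span_scale vec.span_sum) (simp add: scaleR_eq_smult vec.span_scale)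
qed

lemma csolution_in_span_ge0:
  assumes "u \<in> vec.span (gen_eigvecs_ge0 A)"
  shows "\<exists>Y. csolution A Y \<and> Y 0 = u \<and> (\<forall>t. Y t \<in> vec.span (gen_eigvecs_ge0 A))"
  using assms
proof (induction rule: vec.span_induct_alt)
  case base
  show ?case using csolution_0 vec.span_zero by blast
next
  case (step c x y)
  then obtain Yy where Yy: "csolution A Yy" "Yy 0 = y" "\<forall>t. Yy t \<in> vec.span (gen_eigvecs_ge0 A)"
    by blast
  obtain \<mu> k where \<mu>: "Re \<mu> \<ge> 0" "(eig_shift (cmat A) \<mu> ^^ k) x = 0"
    using step(1) unfolding gen_eigvecs_ge0_def gen_eigvec_iff gen_eigenspace_def by blast
  then have x: "x \<in> gen_eigenspace (cmat A) \<mu>" by (auto simp: gen_eigenspace_def)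
  define Y where "Y t = c *s gen_eig_sol A \<mu> x k t + Yy t" for t
  have "csolution A Y"
    unfolding Y_def[abs_def] by (intro csolution_add csolution_smult csolution_gen_eig_sol \<mu>(2) Yy(1))
  moreover have "Y 0 = c *s x + y"
    by (simp add: Y_def gen_eig_sol_at_0[OF \<mu>(2)] Yy(2))
  moreover have "Y t \<in> vec.span (gen_eigvecs_ge0 A)" for t
    unfolding Y_def using gen_eig_sol_in_span_ge0[OF \<mu>(1) x] Yy(3)
    by (intro vec.span_add vec.span_scale) auto
  ultimately show ?case by blast
qed

lemma solution_approaches_E_ge0:
  "\<exists>X U. solution A X \<and> X 0 = x0 \<and> (\<forall>t. U t \<in> E_ge0 A) \<and> exp_decaying (\<lambda>t. X t - U t)"
proof -
  obtain u w where uw: "cvec x0 = u + w" "u \<in> vec.span (gen_eigvecs_ge0 A)"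
      "w \<in> vec.span (gen_eigvecs_lt0 A)"
    using span_ge0_lt0_decomp by blast
  obtain Yu where Yu: "csolution A Yu" "Yu 0 = u" "\<forall>t. Yu t \<in> vec.span (gen_eigvecs_ge0 A)"
    using csolution_in_span_ge0[OF uw(2)] by blast
  obtain Yw where Yw: "csolution A Yw" "Yw 0 = w" "exp_decaying Yw"
    using decaying_csolution_from_span_lt0[OF uw(3)] by blast
  define X where "X t = Re_vec (Yu t + Yw t)" for t
  have "solution A X" unfolding X_def[abs_def] by (intro solution_Re_vec csolution_add Yu Yw)
  moreover have "X 0 = x0" by (simp add: X_def Yu(2) Yw(2) uw(1)[symmetric])
  moreover have "\<forall>t. Re_vec (Yu t) \<in> E_ge0 A" using Yu(3) Re_vec_in_E_ge0 by blast
  moreover have "exp_decaying (\<lambda>t. X t - Re_vec (Yu t))"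
    using exp_decaying_bounded_linear[OF bounded_linear_Re_vec Yw(3)] by (simp add: X_def Re_vec_add)
  ultimately show ?thesis by (intro exI[of _ X] exI[of _ "\<lambda>t. Re_vec (Yu t)"]) blast
qed

lemma solution_exists: "\<exists>X. solution A X \<and> X 0 = x0"
  using solution_approaches_E_ge0 by blast

section \<open>Orthogonal projection onto the orthogonal complement\<close>

definition orthonormal_basis :: "'a::euclidean_space set \<Rightarrow> 'a set" where
  "orthonormal_basis E = (SOME B. B \<subseteq> E \<and> pairwise orthogonal B \<and> (\<forall>x\<in>B. norm x = 1) \<and>
     independent B \<and> span B = E)"

lemma orthonormal_basis:
  assumes "subspace E"
  shows "orthonormal_basis E \<subseteq> E" "pairwise orthogonal (orthonormal_basis E)"
    "\<forall>x\<in>orthonormal_basis E. norm x = 1" "finite (orthonormal_basis E)"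
    "span (orthonormal_basis E) = E"
proof -
  have "\<exists>B. B \<subseteq> E \<and> pairwise orthogonal B \<and> (\<forall>x\<in>B. norm x = 1) \<and> independent B \<and> span B = E"
    using orthonormal_basis_subspace[OF assms] by metis
  then have B: "orthonormal_basis E \<subseteq> E \<and> pairwise orthogonal (orthonormal_basis E) \<and>
      (\<forall>x\<in>orthonormal_basis E. norm x = 1) \<and> independent (orthonormal_basis E) \<and>
      span (orthonormal_basis E) = E"
    unfolding orthonormal_basis_def by (rule someI_ex)
  then show "orthonormal_basis E \<subseteq> E" "pairwise orthogonal (orthonormal_basis E)"
    "\<forall>x\<in>orthonormal_basis E. norm x = 1" "span (orthonormal_basis E) = E"
    by auto
  show "finite (orthonormal_basis E)" using B independent_imp_finite by blast
qed

definition perp_proj :: "'a::euclidean_space set \<Rightarrow> 'a \<Rightarrow> 'a" where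
  "perp_proj E x = x - (\<Sum>b\<in>orthonormal_basis E. (x \<bullet> b) *\<^sub>R b)"

lemma linear_perp_proj: "linear (perp_proj E)"
  by (rule linearI)
    (simp_all add: perp_proj_def sum.distrib scaleR_sum_right algebra_simps)

lemma bounded_linear_perp_proj: "bounded_linear (perp_proj E)"
  using linear_perp_proj linear_conv_bounded_linear by blast

lemma perp_proj_orthogonal:
  assumes E: "subspace E" and e: "e \<in> E"
  shows "perp_proj E x \<bullet> e = 0"
proof -
  let ?B = "orthonormal_basis E"
  have "perp_proj E x \<bullet> b = 0" if b: "b \<in> ?B" for b
  proof -
    have "(\<Sum>c\<in>?B. ((x \<bullet> c) *\<^sub>R c) \<bullet> b) = (\<Sum>c\<in>?B. if c = b then x \<bullet> b else 0)"
    proof (rule sum.cong)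
      fix c assume c: "c \<in> ?B"
      have "b \<bullet> b = 1" using orthonormal_basis(3)[OF E] b by (simp add: dot_square_norm)
      moreover have "c \<noteq> b \<Longrightarrow> c \<bullet> b = 0"
        using orthonormal_basis(2)[OF E] b c by (auto simp: pairwise_def orthogonal_def)
      ultimately show "((x \<bullet> c) *\<^sub>R c) \<bullet> b = (if c = b then x \<bullet> b else 0)" by auto
    qed simp
    also have "\<dots> = x \<bullet> b" using b orthonormal_basis(4)[OF E] by simp
    finally show ?thesis by (simp add: perp_proj_def inner_diff_left inner_sum_left)
  qed
  then have "orthogonal (perp_proj E x) e"
    using orthogonal_to_span[of e ?B] e orthonormal_basis(5)[OF E] by (auto simp: orthogonal_def)
  then show ?thesis by (simp add: orthogonal_def)
qed

lemma diff_perp_proj_in: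
  assumes "subspace E"
  shows "x - perp_proj E x \<in> E"
proof -
  have "(\<Sum>b\<in>orthonormal_basis E. (x \<bullet> b) *\<^sub>R b) \<in> span (orthonormal_basis E)"
    by (intro span_sum span_scale span_base)
  then show ?thesis using orthonormal_basis(5)[OF assms] by (simp add: perp_proj_def)
qed

lemma perp_proj_eq_0_iff:
  assumes E: "subspace E"
  shows "perp_proj E x = 0 \<longleftrightarrow> x \<in> E"
proof
  assume x: "x \<in> E"
  have "perp_proj E x = x - (x - perp_proj E x)" by simp
  also have "\<dots> \<in> E" by (rule subspace_diff[OF E x diff_perp_proj_in[OF E]])
  finally have "perp_proj E x \<bullet> perp_proj E x = 0" using perp_proj_orthogonal[OF E] by blast
  then show "perp_proj E x = 0" by simp
qed (use diff_perp_proj_in[OF E, of x] in simp)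

lemma perp_proj_add_in:
  assumes E: "subspace E" and e: "e \<in> E"
  shows "perp_proj E (y + e) = perp_proj E y"
  using perp_proj_eq_0_iff[OF E] e by (simp add: linear_add[OF linear_perp_proj])

lemma perp_proj_idem:
  assumes E: "subspace E"
  shows "perp_proj E (perp_proj E x) = perp_proj E x"
  using perp_proj_add_in[OF E diff_perp_proj_in[OF E], of "perp_proj E x" x] by simp

lemma perp_proj_symmetric:
  assumes E: "subspace E"
  shows "perp_proj E x \<bullet> y = x \<bullet> perp_proj E y"
proof -
  have "perp_proj E x \<bullet> y = perp_proj E x \<bullet> (perp_proj E y + (y - perp_proj E y))" by simp
  also have "\<dots> = perp_proj E x \<bullet> perp_proj E y"
    by (simp only: inner_add_right perp_proj_orthogonal[OF E diff_perp_proj_in[OF E]] add_0_right)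
  also have "\<dots> = perp_proj E x \<bullet> perp_proj E y + (x - perp_proj E x) \<bullet> perp_proj E y"
    using perp_proj_orthogonal[OF E diff_perp_proj_in[OF E], of y x] by (simp add: inner_commute)
  also have "\<dots> = x \<bullet> perp_proj E y" by (simp add: inner_diff_left)
  finally show ?thesis .
qed

lemma inner_perp_proj_self:
  assumes E: "subspace E"
  shows "x \<bullet> perp_proj E x = perp_proj E x \<bullet> perp_proj E x"
  using perp_proj_symmetric[OF E, of x "perp_proj E x"] perp_proj_idem[OF E] by simp

definition perp_proj_mat :: "(real^'n) set \<Rightarrow> real^'n^'n" where
  "perp_proj_mat E = matrix (perp_proj E)"

lemma perp_proj_mat_mult: "perp_proj_mat E *v x = perp_proj E x"
  unfolding perp_proj_mat_def using matrix_vector_mul(2)[OF linear_perp_proj] by metis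

lemma perp_proj_mat_in_psd_ker:
  assumes E: "subspace E"
  shows "perp_proj_mat E \<in> psd_ker E"
proof -
  have entry: "M $ i $ j = axis i 1 \<bullet> (M *v axis j 1)" for M :: "real^'n^'n" and i j
    by (simp add: matrix_vector_mult_basis column_def inner_axis')
  have "transpose (perp_proj_mat E) $ i $ j = perp_proj_mat E $ i $ j" for i j
    using perp_proj_symmetric[OF E, of "axis j 1" "axis i 1"]
    by (simp add: transpose_def entry perp_proj_mat_mult inner_commute)
  then have "transpose (perp_proj_mat E) = perp_proj_mat E" by (simp add: vec_eq_iff)
  then show ?thesis
    by (simp add: psd_ker_def perp_proj_mat_mult inner_perp_proj_self[OF E] perp_proj_eq_0_iff[OF E])
qed

section \<open>Seminorms\<close>

lemma seminorm_nonneg: "seminorm p \<Longrightarrow> 0 \<le> p x"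
  unfolding seminorm_def by blast

lemma seminorm_scale: "seminorm p \<Longrightarrow> p (c *\<^sub>R x) = \<bar>c\<bar> * p x"
  unfolding seminorm_def by blast

lemma seminorm_triangle: "seminorm p \<Longrightarrow> p (x + y) \<le> p x + p y"
  unfolding seminorm_def by blast

lemma seminorm_0: "seminorm p \<Longrightarrow> p 0 = 0"
  using seminorm_scale[of p 0 0] by simp

lemma seminorm_minus: "seminorm p \<Longrightarrow> p (- x) = p x"
  using seminorm_scale[of p "-1" x] by simp

lemma seminorm_add_ker:
  assumes p: "seminorm p" and e: "p e = 0"
  shows "p (x + e) = p x"
  using seminorm_triangle[OF p, of x e] seminorm_triangle[OF p, of "x + e" "- e"] e seminorm_minus[OF p, of e]
  by simp

lemma seminorm_sum: "seminorm p \<Longrightarrow> p (\<Sum>i\<in>S. f i) \<le> (\<Sum>i\<in>S. p (f i))"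
proof (induction S rule: infinite_finite_induct)
  case (insert i F)
  then show ?case using seminorm_triangle[OF insert.prems, of "f i" "\<Sum>i\<in>F. f i"] by simp
qed (simp_all add: seminorm_0)

lemma seminorm_le_norm:
  fixes p :: "real^'n \<Rightarrow> real"
  assumes p: "seminorm p"
  shows "\<exists>C\<ge>0. \<forall>x. p x \<le> C * norm x"
proof (intro exI[of _ "\<Sum>i\<in>UNIV. p (axis i 1)"] conjI allI)
  show "0 \<le> (\<Sum>i\<in>UNIV. p (axis i 1))" by (intro sum_nonneg seminorm_nonneg[OF p])
  fix x :: "real^'n"
  have "p x = p (\<Sum>i\<in>UNIV. x$i *\<^sub>R axis i 1)"
    using basis_expansion[of x] by (simp add: scalar_mult_eq_scaleR)
  also have "\<dots> \<le> (\<Sum>i\<in>UNIV. p (x$i *\<^sub>R axis i 1))" by (rule seminorm_sum[OF p])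
  also have "\<dots> = (\<Sum>i\<in>UNIV. \<bar>x$i\<bar> * p (axis i 1))" by (simp add: seminorm_scale[OF p])
  also have "\<dots> \<le> (\<Sum>i\<in>UNIV. norm x * p (axis i 1))"
    by (intro sum_mono mult_right_mono component_le_norm_cart seminorm_nonneg[OF p])
  finally show "p x \<le> (\<Sum>i\<in>UNIV. p (axis i 1)) * norm x" by (simp add: sum_distrib_left mult.commute)
qed

lemma continuous_on_seminorm:
  fixes p :: "real^'n \<Rightarrow> real"
  assumes p: "seminorm p"
  shows "continuous_on UNIV p"
proof (rule convex_on_continuous[OF open_UNIV], rule convex_onI)
  fix t :: real and x y :: "real^'n" assume t: "0 < t" "t < 1"
  have "p ((1 - t) *\<^sub>R x + t *\<^sub>R y) \<le> p ((1 - t) *\<^sub>R x) + p (t *\<^sub>R y)" by (rule seminorm_triangle[OF p])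
  also have "\<dots> = (1 - t) * p x + t * p y" using t by (simp add: seminorm_scale[OF p])
  finally show "p ((1 - t) *\<^sub>R x + t *\<^sub>R y) \<le> (1 - t) * p x + t * p y" .
qed simp

lemma seminorm_perp_proj:
  assumes E: "subspace E" and p: "seminorm p" and ker: "seminorm_ker p = E"
  shows "p (perp_proj E x) = p x"
proof -
  have "p (x - perp_proj E x) = 0" using diff_perp_proj_in[OF E, of x] ker by (auto simp: seminorm_ker_def)
  then show ?thesis using seminorm_add_ker[OF p, of "x - perp_proj E x" "perp_proj E x"] by simp
qed

text \<open>On \<open>E\<^sup>\<bottom>\<close> the seminorm is a norm, hence bounded below on the compact unit sphere of \<open>E\<^sup>\<bottom>\<close>.\<close>
lemma seminorm_ge_perp_proj:
  assumes E: "subspace E" and p: "seminorm p" and ker: "seminorm_ker p = E"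
  shows "\<exists>c>0. \<forall>x. c * norm (perp_proj E x) \<le> p x"
proof -
  define S where "S = sphere 0 1 \<inter> {z. perp_proj E z = z}"
  have "compact S" unfolding S_def
    by (intro compact_Int_closed compact_sphere closed_Collect_eq linear_continuous_on
        bounded_linear_perp_proj continuous_on_id)
  have unit: "(1 / norm (perp_proj E x)) *\<^sub>R perp_proj E x \<in> S" if "perp_proj E x \<noteq> 0" for x
    using that by (simp add: S_def linear_scale[OF linear_perp_proj] perp_proj_idem[OF E])
  show ?thesis
  proof (cases "S = {}")
    case True
    then have "perp_proj E x = 0" for x using unit by blast
    then show ?thesis using seminorm_nonneg[OF p] by (intro exI[of _ 1]) auto
  next
    case False
    obtain z where z: "z \<in> S" "\<forall>y\<in>S. p z \<le> p y"
      using continuous_attains_inf[OF \<open>compact S\<close> False continuous_on_subset[OF continuous_on_seminorm[OF p]]]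
      by blast
    have "z \<notin> E" using z(1) perp_proj_eq_0_iff[OF E, of z] by (auto simp: S_def)
    then have pz: "p z > 0"
      using seminorm_nonneg[OF p, of z] ker by (auto simp: seminorm_ker_def order_le_less)
    have "p z * norm (perp_proj E x) \<le> p x" for x
    proof (cases "perp_proj E x = 0")
      case True
      then show ?thesis using seminorm_nonneg[OF p] by simp
    next
      case False
      define n where "n = norm (perp_proj E x)"
      have n: "n > 0" using False by (simp add: n_def)
      have "p z \<le> p ((1 / n) *\<^sub>R perp_proj E x)" using z(2) unit[OF False] by (simp add: n_def)
      also have "\<dots> = p x / n" using n by (simp add: seminorm_scale[OF p] seminorm_perp_proj[OF E p ker])
      finally show ?thesis using n by (simp add: n_def field_simps)
    qed
    then show ?thesis using pz by blast
  qed
qed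

section \<open>Statement (1) implies statement (3)\<close>

text \<open>With \<open>K\<close> the operator norm of \<open>L\<close>, the function \<open>\<parallel>d s\<parallel>\<^sup>2 e\<^sup>-\<^sup>2\<^sup>K\<^sup>s\<close> is nonincreasing.\<close>
lemma linear_ode_zero_unique:
  fixes d :: "real \<Rightarrow> 'a::real_inner"
  assumes L: "bounded_linear L"
    and d: "\<And>s. s \<ge> 0 \<Longrightarrow> (d has_vector_derivative L (d s)) (at s within {0..})"
    and d0: "d 0 = 0" and t: "t \<ge> 0"
  shows "d t = 0"
proof -
  define K where "K = onorm L"
  have K: "d s \<bullet> L (d s) \<le> K * (d s \<bullet> d s)" for s
  proof -
    have "d s \<bullet> L (d s) \<le> norm (d s) * norm (L (d s))" by (rule norm_cauchy_schwarz)
    also have "\<dots> \<le> norm (d s) * (K * norm (d s))"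
      unfolding K_def by (intro mult_left_mono onorm[OF L]) simp
    finally show ?thesis by (simp add: dot_square_norm power2_eq_square mult_ac)
  qed
  define g where "g s = (d s \<bullet> d s) * exp (-2*K * s)" for s
  define g' where "g' s = 2 * exp (-2*K * s) * (d s \<bullet> L (d s) - K * (d s \<bullet> d s))" for s
  have g': "(g has_real_derivative g' s) (at s within {0..})" if "s \<ge> 0" for s
  proof -
    have "((\<lambda>s. d s \<bullet> d s) has_real_derivative (d s \<bullet> L (d s) + L (d s) \<bullet> d s)) (at s within {0..})"
      unfolding has_real_derivative_iff_has_vector_derivative
      using bounded_bilinear.has_vector_derivative[OF bounded_bilinear_inner d[OF that] d[OF that]] .
    from DERIV_mult[OF this DERIV_exp[THEN DERIV_chain2, OF DERIV_cmult_Id[of "-2*K"]]]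
    show ?thesis unfolding g_def[abs_def] g'_def
      by (rule DERIV_cong) (simp add: inner_commute algebra_simps)
  qed
  have "g t \<le> g 0"
  proof (rule DERIV_nonpos_imp_decreasing_open[OF t])
    fix s assume s: "0 < s" "s < t"
    have "at s within {0..} = at s" by (rule at_within_interior) (use s in simp)
    then have "(g has_real_derivative g' s) (at s)" using g'[of s] s by simp
    moreover have "g' s \<le> 0" unfolding g'_def using K[of s] by (intro mult_nonneg_nonpos) auto
    ultimately show "\<exists>y. (g has_real_derivative y) (at s) \<and> y \<le> 0" by blast
  next
    show "continuous_on {0..t} g"
      by (rule DERIV_continuous_on[OF DERIV_subset[OF g']]) auto
  qed
  moreover have "g 0 = 0" by (simp add: g_def d0)
  moreover have "g t \<ge> 0" by (simp add: g_def)
  ultimately have "g t = 0" by simp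
  then show ?thesis by (simp add: g_def)
qed

lemma perp_proj_mult_invariant:
  assumes E: "subspace E" and inv: "\<forall>x\<in>E. A *v x \<in> E"
  shows "perp_proj E (A *v w) = perp_proj E (A *v perp_proj E w)"
proof -
  have "A *v w = A *v perp_proj E w + A *v (w - perp_proj E w)"
    by (simp flip: matrix_vector_right_distrib)
  moreover have "A *v (w - perp_proj E w) \<in> E" using inv diff_perp_proj_in[OF E] by blast
  ultimately show ?thesis using perp_proj_add_in[OF E] by metis
qed

text \<open>For \<open>A\<close>-invariant \<open>E\<close>, the projection \<open>perp_proj E x\<close> of a solution solves the autonomous
  equation \<open>y' = perp_proj E (A y)\<close>; so it is determined by \<open>perp_proj E (x 0)\<close>.\<close>
lemma perp_proj_solution_eq:
  assumes E: "subspace E" and inv: "\<forall>x\<in>E. A *v x \<in> E"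
    and x: "\<forall>t\<ge>0. (x has_vector_derivative (A *v x t)) (at t within {0..})"
    and X: "solution A X" and x0: "perp_proj E (x 0) = perp_proj E (X 0)" and t: "t \<ge> 0"
  shows "perp_proj E (x t) = perp_proj E (X t)"
proof -
  define d where "d s = perp_proj E (x s) - perp_proj E (X s)" for s
  let ?L = "\<lambda>y. perp_proj E (A *v y)"
  have L: "bounded_linear ?L"
    by (intro bounded_linear_compose[OF bounded_linear_perp_proj] matrix_vector_mul_bounded_linear)
  have "(d has_vector_derivative ?L (d s)) (at s within {0..})" if s: "s \<ge> 0" for s
  proof -
    have "(d has_vector_derivative (perp_proj E (A *v x s) - perp_proj E (A *v X s))) (at s within {0..})"
      unfolding d_def[abs_def] using x s solution_within[OF X]
      by (intro has_vector_derivative_diff bounded_linear.has_vector_derivative[OF bounded_linear_perp_proj])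
        auto
    moreover have "perp_proj E (A *v x s) - perp_proj E (A *v X s) = ?L (d s)"
      using perp_proj_mult_invariant[OF E inv, of "x s - X s"]
      by (simp add: d_def linear_diff[OF linear_perp_proj] matrix_vector_mult_diff_distrib)
    ultimately show ?thesis by simp
  qed
  moreover have "d 0 = 0" using x0 by (simp add: d_def)
  ultimately have "d t = 0" using linear_ode_zero_unique[OF L _ _ t] by blast
  then show ?thesis by (simp add: d_def)
qed

lemma solution_perp_proj_decaying:
  assumes E: "subspace E" and ge: "E_ge0 A \<subseteq> E"
  shows "\<exists>X. solution A X \<and> X 0 = x0 \<and> exp_decaying (\<lambda>t. perp_proj E (X t))"
proof -
  obtain X U where X: "solution A X" "X 0 = x0" and U: "\<forall>t. U t \<in> E_ge0 A"
    and dec: "exp_decaying (\<lambda>t. X t - U t)"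
    using solution_approaches_E_ge0 by blast
  have "perp_proj E (X t - U t) = perp_proj E (X t)" for t
    using U ge perp_proj_eq_0_iff[OF E, of "U t"] by (auto simp: linear_diff[OF linear_perp_proj])
  then have "exp_decaying (\<lambda>t. perp_proj E (X t))"
    using exp_decaying_bounded_linear[OF bounded_linear_perp_proj[of E] dec] by simp
  with X show ?thesis by blast
qed

lemma uniform_exp_decay_perp_proj:
  assumes E: "subspace E" and ge: "E_ge0 A \<subseteq> E"
  shows "\<exists>K \<beta>. K \<ge> 0 \<and> \<beta> > 0 \<and> (\<forall>z. \<exists>X. solution A X \<and> X 0 = z \<and>
           (\<forall>t\<ge>0. norm (perp_proj E (X t)) \<le> K * norm z * exp (-\<beta> * t)))"
proof -
  have "\<forall>i. \<exists>X M \<beta>. solution A X \<and> X 0 = axis i 1 \<and> \<beta> > 0 \<and>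
      (\<forall>t\<ge>0. norm (perp_proj E (X t)) \<le> M * exp (-\<beta> * t))"
    using solution_perp_proj_decaying[OF E ge] unfolding exp_decaying_def by blast
  then obtain Xb Mb \<beta>b where Xb: "\<And>i. solution A (Xb i)" "\<And>i. Xb i 0 = axis i 1" "\<And>i. \<beta>b i > 0"
      "\<And>i t. t \<ge> 0 \<Longrightarrow> norm (perp_proj E (Xb i t)) \<le> Mb i * exp (-\<beta>b i * t)"
    by metis
  define \<beta> where "\<beta> = Min (range \<beta>b)"
  have "\<beta> \<in> range \<beta>b" unfolding \<beta>_def by (rule Min_in) auto
  then have \<beta>: "\<beta> > 0" using Xb(3) by auto
  have "\<beta> \<le> \<beta>b i" for i unfolding \<beta>_def by (rule Min_le) auto
  then have Xb_decay: "norm (perp_proj E (Xb i t)) \<le> \<bar>Mb i\<bar> * exp (-\<beta> * t)" if "t \<ge> 0" for i t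
    using order_trans[OF Xb(4)[OF that] exp_decay_mono[OF _ that]] by blast
  define K where "K = (\<Sum>i\<in>UNIV. \<bar>Mb i\<bar>)"
  have "\<exists>X. solution A X \<and> X 0 = z \<and> (\<forall>t\<ge>0. norm (perp_proj E (X t)) \<le> K * norm z * exp (-\<beta> * t))"
    for z
  proof (intro exI conjI allI impI)
    let ?X = "\<lambda>t. \<Sum>i\<in>UNIV. z$i *\<^sub>R Xb i t"
    show "solution A ?X" by (intro solution_sum solution_scaleR Xb(1))
    show "?X 0 = z" using basis_expansion[of z] by (simp add: Xb(2) scalar_mult_eq_scaleR)
    fix t :: real assume t: "t \<ge> 0"
    have "norm (perp_proj E (?X t)) \<le> (\<Sum>i\<in>UNIV. \<bar>z$i\<bar> * norm (perp_proj E (Xb i t)))"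
      using norm_sum[of "\<lambda>i. z$i *\<^sub>R perp_proj E (Xb i t)" UNIV]
      by (simp add: linear_sum[OF linear_perp_proj] linear_scale[OF linear_perp_proj])
    also have "\<dots> \<le> (\<Sum>i\<in>UNIV. norm z * (\<bar>Mb i\<bar> * exp (-\<beta> * t)))"
      using Xb_decay[OF t] by (intro sum_mono mult_mono component_le_norm_cart) auto
    also have "\<dots> = K * norm z * exp (-\<beta> * t)"
      by (simp add: K_def sum_distrib_left sum_distrib_right mult_ac)
    finally show "norm (perp_proj E (?X t)) \<le> K * norm z * exp (-\<beta> * t)" .
  qed
  moreover have "K \<ge> 0" by (simp add: K_def sum_nonneg)
  ultimately show ?thesis using \<beta> by blast
qed

lemma ges_wrt_if_stmt1:
  assumes E: "subspace E" and s1: "stmt1 A E" and p: "seminorm p" and ker: "seminorm_ker p = E"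
  shows "ges_wrt A p"
proof -
  have inv: "\<forall>x\<in>E. A *v x \<in> E" and ge: "E_ge0 A \<subseteq> E" using s1 by (auto simp: stmt1_def)
  obtain K \<beta> where K: "K \<ge> 0" and \<beta>: "\<beta> > 0" and decay: "\<And>z. \<exists>X. solution A X \<and> X 0 = z \<and>
      (\<forall>t\<ge>0. norm (perp_proj E (X t)) \<le> K * norm z * exp (-\<beta> * t))"
    using uniform_exp_decay_perp_proj[OF E ge] by blast
  obtain C where C: "C \<ge> 0" "\<And>x. p x \<le> C * norm x" using seminorm_le_norm[OF p] by blast
  obtain c where c: "c > 0" "\<And>x. c * norm (perp_proj E x) \<le> p x"
    using seminorm_ge_perp_proj[OF E p ker] by blast
  have "p (x t) \<le> (C * K / c) * p (x 0) * exp (-\<beta> * t)"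
    if x: "\<forall>t\<ge>0. (x has_vector_derivative (A *v x t)) (at t within {0..})" and t: "t \<ge> 0" for x t
  proof -
    obtain X where X: "solution A X" "X 0 = perp_proj E (x 0)"
      "\<forall>t\<ge>0. norm (perp_proj E (X t)) \<le> K * norm (perp_proj E (x 0)) * exp (-\<beta> * t)"
      using decay by blast
    have "perp_proj E (x t) = perp_proj E (X t)"
      using perp_proj_solution_eq[OF E inv x X(1) _ t] X(2) perp_proj_idem[OF E] by simp
    then have "p (x t) \<le> C * norm (perp_proj E (X t))"
      using C(2)[of "perp_proj E (X t)"] seminorm_perp_proj[OF E p ker, of "x t"] by simp
    also have "\<dots> \<le> C * (K * norm (perp_proj E (x 0)) * exp (-\<beta> * t))"
      using X(3) t C(1) by (simp add: mult_left_mono)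
    also have "\<dots> \<le> C * (K * (p (x 0) / c) * exp (-\<beta> * t))"
      using c C(1) K by (intro mult_left_mono mult_right_mono) (auto simp: field_simps)
    finally show ?thesis by simp
  qed
  moreover have "C * K / c + 1 > 0" using C(1) K c(1) by (simp add: add_nonneg_pos)
  moreover have "(C * K / c) * p y * exp (-\<beta> * t) \<le> (C * K / c + 1) * p y * exp (-\<beta> * t)" for y t
    using seminorm_nonneg[OF p, of y] by (intro mult_right_mono) auto
  ultimately show ?thesis unfolding ges_wrt_def using \<beta> by (meson order_trans)
qed

lemma stmt1_imp_stmt3: "subspace E \<Longrightarrow> stmt1 A E \<Longrightarrow> stmt3 A E"
  unfolding stmt3_def using ges_wrt_if_stmt1 by blast

lemma seminorm_norm_perp_proj:
  assumes "subspace E"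
  shows "seminorm (\<lambda>x. norm (perp_proj E x))" "seminorm_ker (\<lambda>x. norm (perp_proj E x)) = E"
  using perp_proj_eq_0_iff[OF assms]
  by (auto simp: seminorm_def seminorm_ker_def linear_add[OF linear_perp_proj]
      linear_scale[OF linear_perp_proj] norm_triangle_ineq)

lemma stmt3_imp_stmt2: "subspace E \<Longrightarrow> stmt3 A E \<Longrightarrow> stmt2 A E"
  unfolding stmt3_def stmt2_def using seminorm_norm_perp_proj by blast

section \<open>Complexification of a subspace\<close>

definition complexify :: "(real^'n) set \<Rightarrow> (complex^'n) set" where
  "complexify E = {z. Re_vec z \<in> E \<and> Im_vec z \<in> E}"

lemma subspace_complexify: "subspace E \<Longrightarrow> vec.subspace (complexify E)"
  unfolding vec.subspace_def complexify_def
  by (auto simp: Re_vec_add Im_vec_add Re_vec_smult Im_vec_smult subspace_0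
      intro!: subspace_diff subspace_add subspace_scale)

lemma eig_shift_in_complexify:
  assumes E: "subspace E" and inv: "\<forall>x\<in>E. A *v x \<in> E" and z: "z \<in> complexify E"
  shows "eig_shift (cmat A) \<mu> z \<in> complexify E"
  using z E inv
  by (auto simp: complexify_def eig_shift_def Re_vec_diff Im_vec_diff Re_vec_mult Im_vec_mult
      Re_vec_smult Im_vec_smult intro!: subspace_diff subspace_add subspace_scale)

text \<open>To show \<open>E_ge0 A \<subseteq> E\<close> it suffices to descend one step along a Jordan chain: for
  \<open>Re \<mu> \<ge> 0\<close>, if \<open>(A - \<mu>) v\<close> is in the complexification of \<open>E\<close>, so is \<open>v\<close>.\<close>
lemma E_ge0_subsetI:
  assumes E: "subspace E"
    and step: "\<And>\<mu> k v. Re \<mu> \<ge> 0 \<Longrightarrow> (eig_shift (cmat A) \<mu> ^^ Suc k) v = 0 \<Longrightarrow>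
      eig_shift (cmat A) \<mu> v \<in> complexify E \<Longrightarrow> v \<in> complexify E"
  shows "E_ge0 A \<subseteq> E"
proof -
  have chain: "(eig_shift (cmat A) \<mu> ^^ k) v = 0 \<Longrightarrow> Re \<mu> \<ge> 0 \<Longrightarrow> v \<in> complexify E" for k \<mu> v
  proof (induction k arbitrary: v)
    case 0
    then show ?case using vec.subspace_0[OF subspace_complexify[OF E]] by simp
  next
    case (Suc k)
    then have "eig_shift (cmat A) \<mu> v \<in> complexify E"
      by (simp only: funpow_Suc_right o_apply)
    then show ?case using step Suc.prems by blast
  qed
  then have "gen_eigvecs_ge0 A \<subseteq> complexify E"
    by (auto simp: gen_eigvecs_ge0_def gen_eigvec_iff gen_eigenspace_def)
  then have "vec.span (gen_eigvecs_ge0 A) \<subseteq> complexify E"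
    by (rule vec.span_minimal[OF _ subspace_complexify[OF E]])
  then show ?thesis by (auto simp: E_ge0_eq complexify_def)
qed

section \<open>Statement (4) implies statement (1)\<close>

lemma inner_transpose_mult: "y \<bullet> (transpose M *v z) = (M *v y) \<bullet> (z :: real^'n)"
  by (metis dot_lmul_matrix inner_commute transpose_matrix_vector)

lemma inner_symmetric_mult: "transpose P = P \<Longrightarrow> y \<bullet> (P *v z) = (P *v y) \<bullet> (z :: real^'n)"
  using inner_transpose_mult[of y P z] by simp

text \<open>Cauchy-Schwarz for the semi-inner product \<open>(x, y) \<mapsto> x \<bullet> Q y\<close>.\<close>
lemma psd_mult_eq_0:
  fixes Q :: "real^'n^'n"
  assumes sym: "transpose Q = Q" and psd: "\<forall>x. 0 \<le> x \<bullet> (Q *v x)" and x0: "x \<bullet> (Q *v x) = 0"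
  shows "Q *v x = 0"
proof -
  define w where "w = Q *v x"
  define s where "s = w \<bullet> w"
  define c where "c = w \<bullet> (Q *v w)"
  have c: "c \<ge> 0" using psd by (simp add: c_def)
  have H: "0 \<le> 2 * r * s + r^2 * c" for r
  proof -
    have "0 \<le> (x + r *\<^sub>R w) \<bullet> (Q *v (x + r *\<^sub>R w))" using psd by blast
    also have "\<dots> = 2 * r * s + r^2 * c"
      using x0 inner_symmetric_mult[OF sym, of x w]
      by (simp add: w_def s_def c_def algebra_simps power2_eq_square)
    finally show ?thesis .
  qed
  have "s = 0"
  proof (cases "c = 0")
    case True
    then have "s \<le> 0" using H[of "-1"] by simp
    then show ?thesis using inner_ge_zero[of w] unfolding s_def by linarith
  next
    case False
    have "0 \<le> 2 * (-s/c) * s + (-s/c)^2 * c" by (rule H)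
    also have "\<dots> = - (s^2 / c)" using False by (simp add: power2_eq_square field_simps)
    finally show ?thesis using c False by (simp add: divide_le_0_iff)
  qed
  then show ?thesis by (simp add: s_def w_def)
qed

lemma lyapunov_mult:
  fixes A P Q :: "real^'n^'n"
  assumes "transpose A ** P + P ** A + Q = 0"
  shows "transpose A *v (P *v y) + P *v (A *v y) + Q *v y = 0"
proof -
  have "(transpose A ** P + P ** A + Q) *v y = 0" using assms by simp
  then show ?thesis by (simp add: matrix_vector_mult_add_rdistrib matrix_vector_mul_assoc[symmetric])
qed

lemma lyapunov_quadratic:
  fixes A P Q :: "real^'n^'n"
  assumes P: "transpose P = P" and eq: "transpose A ** P + P ** A + Q = 0"
  shows "2 * ((A *v y) \<bullet> (P *v y)) + y \<bullet> (Q *v y) = 0"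
proof -
  have "y \<bullet> (transpose A *v (P *v y) + P *v (A *v y) + Q *v y) = 0"
    using lyapunov_mult[OF eq] by simp
  then show ?thesis
    using inner_transpose_mult[of y A "P *v y"] inner_symmetric_mult[OF P, of y "A *v y"]
    by (simp add: inner_add_right inner_commute)
qed

lemma lyapunov_invariant:
  assumes P: "P \<in> psd_ker E" and Q: "Q \<in> psd_ker E" and eq: "transpose A ** P + P ** A + Q = 0"
    and x: "x \<in> E"
  shows "A *v x \<in> E"
proof -
  have "P *v x = 0" "Q *v x = 0" using P Q x by (auto simp: psd_ker_def)
  then have "P *v (A *v x) = 0" using lyapunov_mult[OF eq, of x] by simp
  then show ?thesis using P by (auto simp: psd_ker_def)
qed

text \<open>Writing \<open>v = a + i b\<close>, the quadratic identity for \<open>a\<close> and \<open>b\<close> gives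
  \<open>2 Re \<mu> (a\<bullet>Pa + b\<bullet>Pb) + a\<bullet>Qa + b\<bullet>Qb = 0\<close>, so \<open>Qa = Qb = 0\<close> when \<open>Re \<mu> \<ge> 0\<close>.\<close>
lemma lyapunov_jordan_step:
  assumes P: "P \<in> psd_ker E" and Q: "Q \<in> psd_ker E" and eq: "transpose A ** P + P ** A + Q = 0"
    and \<mu>: "Re \<mu> \<ge> 0" and u: "eig_shift (cmat A) \<mu> v \<in> complexify E"
  shows "v \<in> complexify E"
proof -
  have Ps: "transpose P = P" "\<forall>x. 0 \<le> x \<bullet> (P *v x)" "\<And>x. P *v x = 0 \<longleftrightarrow> x \<in> E"
    and Qs: "transpose Q = Q" "\<forall>x. 0 \<le> x \<bullet> (Q *v x)" "\<And>x. Q *v x = 0 \<longleftrightarrow> x \<in> E"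
    using P Q by (auto simp: psd_ker_def)
  define a b where "a = Re_vec v" and "b = Im_vec v"
  define ua ub where "ua = Re_vec (eig_shift (cmat A) \<mu> v)" and "ub = Im_vec (eig_shift (cmat A) \<mu> v)"
  have "P *v ua = 0" "P *v ub = 0" using u Ps(3) by (auto simp: complexify_def ua_def ub_def)
  then have ua: "ua \<bullet> (P *v a) = 0" and ub: "ub \<bullet> (P *v b) = 0"
    using inner_symmetric_mult[OF Ps(1), of ua a] inner_symmetric_mult[OF Ps(1), of ub b] by simp_all
  have "A *v a = ua + (Re \<mu> *\<^sub>R a - Im \<mu> *\<^sub>R b)" "A *v b = ub + (Im \<mu> *\<^sub>R a + Re \<mu> *\<^sub>R b)"
    by (simp_all add: ua_def ub_def a_def b_def eig_shift_def Re_vec_diff Re_vec_mult Re_vec_smult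
        Im_vec_diff Im_vec_mult Im_vec_smult)
  then have "(A *v a) \<bullet> (P *v a) = Re \<mu> * (a \<bullet> (P *v a)) - Im \<mu> * (b \<bullet> (P *v a))"
    and "(A *v b) \<bullet> (P *v b) = Im \<mu> * (a \<bullet> (P *v b)) + Re \<mu> * (b \<bullet> (P *v b))"
    using ua ub by (simp_all add: inner_add_left inner_diff_left)
  moreover have "b \<bullet> (P *v a) = a \<bullet> (P *v b)"
    using inner_symmetric_mult[OF Ps(1), of a b] by (simp add: inner_commute)
  ultimately have "2 * (Re \<mu> * (a \<bullet> (P *v a) + b \<bullet> (P *v b))) + (a \<bullet> (Q *v a) + b \<bullet> (Q *v b)) = 0"
    using lyapunov_quadratic[OF Ps(1) eq, of a] lyapunov_quadratic[OF Ps(1) eq, of b]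
    by (simp add: algebra_simps)
  moreover have "0 \<le> Re \<mu> * (a \<bullet> (P *v a) + b \<bullet> (P *v b))" using \<mu> Ps(2) by simp
  moreover have "0 \<le> a \<bullet> (Q *v a)" "0 \<le> b \<bullet> (Q *v b)" using Qs(2) by auto
  ultimately have "a \<bullet> (Q *v a) = 0" "b \<bullet> (Q *v b) = 0" by linarith+
  then have "Q *v a = 0" "Q *v b = 0" using psd_mult_eq_0[OF Qs(1) Qs(2)] by auto
  then show ?thesis using Qs(3) by (simp add: complexify_def a_def b_def)
qed

lemma stmt4_imp_stmt1:
  assumes E: "subspace E" and s4: "stmt4 A E"
  shows "stmt1 A E"
proof -
  obtain P Q where P: "P \<in> psd_ker E" and Q: "Q \<in> psd_ker E"
    and eq: "transpose A ** P + P ** A + Q = 0"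
    using s4 by (auto simp: stmt4_def)
  have "E_ge0 A \<subseteq> E"
    by (rule E_ge0_subsetI[OF E]) (rule lyapunov_jordan_step[OF P Q eq])
  then show ?thesis unfolding stmt1_def using lyapunov_invariant[OF P Q eq] by blast
qed

section \<open>Statement (2) implies statement (1)\<close>

text \<open>A solution starting in \<open>E = ker p\<close> stays in \<open>E\<close>; differentiating at \<open>t = 0\<close> gives \<open>A x\<^sub>0 \<in> E\<close>.\<close>
lemma ges_wrt_ker_invariant:
  assumes E: "subspace E" and p: "seminorm p" and ker: "seminorm_ker p = E" and ges: "ges_wrt A p"
    and x0: "x0 \<in> E"
  shows "A *v x0 \<in> E"
proof -
  obtain \<alpha> \<beta> where H: "\<And>x. \<forall>t\<ge>0. (x has_vector_derivative A *v x t) (at t within {0..}) \<Longrightarrow>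
      \<forall>t\<ge>0. p (x t) \<le> \<alpha> * p (x 0) * exp (- \<beta> * t)"
    using ges unfolding ges_wrt_def by blast
  have in_E: "p x = 0 \<longleftrightarrow> x \<in> E" for x using ker by (auto simp: seminorm_ker_def)
  obtain X where X: "solution A X" "X 0 = x0" using solution_exists by blast
  have "X t \<in> E" if "t \<ge> 0" for t
  proof -
    have "p (X t) \<le> \<alpha> * p (X 0) * exp (-\<beta> * t)"
      using H[OF allI[OF impI[OF solution_within[OF X(1)]]]] that by blast
    moreover have "p (X 0) = 0" using X(2) x0 in_E by simp
    ultimately have "p (X t) = 0" using seminorm_nonneg[OF p, of "X t"] by simp
    then show ?thesis using in_E by simp
  qed
  then have "perp_proj E (X t) = 0" if "t \<in> cbox 0 1" for t
    using that perp_proj_eq_0_iff[OF E] by (simp add: cbox_interval)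
  then have "((\<lambda>t. perp_proj E (X t)) has_vector_derivative 0) (at 0 within cbox 0 1)"
    by (intro has_vector_derivative_transform[where f = "\<lambda>t. 0", OF _ _ has_vector_derivative_const])
      (simp_all add: cbox_interval)
  moreover have "((\<lambda>t. perp_proj E (X t)) has_vector_derivative perp_proj E (A *v X 0)) (at 0 within cbox 0 1)"
    by (rule bounded_linear.has_vector_derivative[OF bounded_linear_perp_proj solution_within[OF X(1)]])
  ultimately have "perp_proj E (A *v X 0) = 0"
    by (intro vector_derivative_unique_within_closed_interval) (auto simp: cbox_interval)
  then show ?thesis using X(2) perp_proj_eq_0_iff[OF E] by simp
qed

definition re_im_seminorm :: "(real^'n \<Rightarrow> real) \<Rightarrow> complex^'n \<Rightarrow> real" where
  "re_im_seminorm p z = p (Re_vec z) + p (Im_vec z)"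

lemma re_im_seminorm_nonneg: "seminorm p \<Longrightarrow> 0 \<le> re_im_seminorm p z"
  by (simp add: re_im_seminorm_def seminorm_nonneg)

lemma re_im_seminorm_smult_le:
  assumes p: "seminorm p"
  shows "re_im_seminorm p (c *s z) \<le> 2 * cmod c * re_im_seminorm p z"
proof -
  have cmod: "\<bar>Re c\<bar> * p x + \<bar>Im c\<bar> * p y \<le> cmod c * p x + cmod c * p y" for x y
    using seminorm_nonneg[OF p] abs_Re_le_cmod[of c] abs_Im_le_cmod[of c]
    by (intro add_mono mult_right_mono) auto
  have "p (Re_vec (c *s z)) \<le> \<bar>Re c\<bar> * p (Re_vec z) + \<bar>Im c\<bar> * p (Im_vec z)"
    using seminorm_triangle[OF p, of "Re c *\<^sub>R Re_vec z" "- (Im c *\<^sub>R Im_vec z)"]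
    by (simp add: Re_vec_smult seminorm_minus[OF p] seminorm_scale[OF p])
  moreover have "p (Im_vec (c *s z)) \<le> \<bar>Re c\<bar> * p (Im_vec z) + \<bar>Im c\<bar> * p (Re_vec z)"
    using seminorm_triangle[OF p, of "Re c *\<^sub>R Im_vec z" "Im c *\<^sub>R Re_vec z"]
    by (simp add: Im_vec_smult seminorm_scale[OF p] add.commute)
  ultimately have "re_im_seminorm p (c *s z) \<le> (\<bar>Re c\<bar> * p (Re_vec z) + \<bar>Im c\<bar> * p (Im_vec z))
      + (\<bar>Re c\<bar> * p (Im_vec z) + \<bar>Im c\<bar> * p (Re_vec z))"
    unfolding re_im_seminorm_def by (rule add_mono)
  also have "\<dots> \<le> (cmod c * p (Re_vec z) + cmod c * p (Im_vec z))
      + (cmod c * p (Im_vec z) + cmod c * p (Re_vec z))"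
    by (intro add_mono cmod)
  also have "\<dots> = 2 * cmod c * re_im_seminorm p z" by (simp add: re_im_seminorm_def algebra_simps)
  finally show ?thesis .
qed

lemma re_im_seminorm_add_complexify:
  assumes p: "seminorm p" and ker: "seminorm_ker p = E" and e: "e \<in> complexify E"
  shows "re_im_seminorm p (z + e) = re_im_seminorm p z"
proof -
  have "p (Re_vec e) = 0" "p (Im_vec e) = 0" using e ker by (auto simp: complexify_def seminorm_ker_def)
  then show ?thesis by (simp add: re_im_seminorm_def Re_vec_add Im_vec_add seminorm_add_ker[OF p])
qed

lemma gen_eig_sol_diff_in_complexify:
  assumes E: "subspace E" and inv: "\<forall>x\<in>E. A *v x \<in> E" and u: "eig_shift (cmat A) \<mu> v \<in> complexify E"
  shows "gen_eig_sol A \<mu> v (Suc k) t - exp (\<mu> * of_real t) *s v \<in> complexify E"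
proof -
  let ?N = "eig_shift (cmat A) \<mu>"
  have N: "(?N ^^ Suc j) v \<in> complexify E" for j
    using u by (induction j) (auto simp: eig_shift_in_complexify[OF E inv])
  have "nilp_exp A \<mu> v (Suc k) t = v + (\<Sum>j<k. (t^Suc j / fact (Suc j)) *\<^sub>R (?N ^^ Suc j) v)"
    by (simp only: nilp_exp_def sum.lessThan_Suc_shift) simp
  then have "gen_eig_sol A \<mu> v (Suc k) t - exp (\<mu> * of_real t) *s v
      = exp (\<mu> * of_real t) *s (\<Sum>j<k. (t^Suc j / fact (Suc j)) *\<^sub>R (?N ^^ Suc j) v)"
    by (simp add: gen_eig_sol_def)
  also have "\<dots> \<in> complexify E"
    using N by (intro vec.subspace_scale[OF subspace_complexify[OF E]] vec.subspace_sum[OF subspace_complexify[OF E]])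
      (simp add: scaleR_eq_smult vec.subspace_scale[OF subspace_complexify[OF E]])
  finally show ?thesis .
qed

lemma re_im_seminorm_bound:
  assumes H: "\<And>x. \<forall>t\<ge>0. (x has_vector_derivative A *v x t) (at t within {0..}) \<Longrightarrow>
      \<forall>t\<ge>0. p (x t) \<le> \<alpha> * p (x 0) * exp (- \<beta> * t)"
    and Y: "csolution A Y" and t: "t \<ge> 0"
  shows "re_im_seminorm p (Y t) \<le> \<alpha> * re_im_seminorm p (Y 0) * exp (- \<beta> * t)"
proof -
  have "p (Re_vec (Y t)) \<le> \<alpha> * p (Re_vec (Y 0)) * exp (- \<beta> * t)"
    using H[OF allI[OF impI[OF solution_within[OF solution_Re_vec[OF Y]]]]] t by blast
  moreover have "p (Im_vec (Y t)) \<le> \<alpha> * p (Im_vec (Y 0)) * exp (- \<beta> * t)"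
    using H[OF allI[OF impI[OF solution_within[OF solution_Im_vec[OF Y]]]]] t by blast
  ultimately show ?thesis by (simp add: re_im_seminorm_def algebra_simps)
qed

text \<open>The solution through \<open>v\<close> is \<open>e\<^sup>\<mu>\<^sup>t v\<close> modulo the complexification of \<open>E = ker p\<close>, and
  \<open>|e\<^sup>\<mu>\<^sup>t| \<ge> 1\<close>; so its seminorm cannot decay unless it vanishes.\<close>
lemma ges_wrt_jordan_step:
  assumes E: "subspace E" and inv: "\<forall>x\<in>E. A *v x \<in> E" and p: "seminorm p"
    and ker: "seminorm_ker p = E" and ges: "ges_wrt A p"
    and \<mu>: "Re \<mu> \<ge> 0" and chain: "(eig_shift (cmat A) \<mu> ^^ Suc k) v = 0"
    and u: "eig_shift (cmat A) \<mu> v \<in> complexify E"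
  shows "v \<in> complexify E"
proof -
  obtain \<alpha> \<beta> where \<beta>: "\<beta> > 0" and H: "\<And>x. \<forall>t\<ge>0. (x has_vector_derivative A *v x t) (at t within {0..}) \<Longrightarrow>
      \<forall>t\<ge>0. p (x t) \<le> \<alpha> * p (x 0) * exp (- \<beta> * t)"
    using ges unfolding ges_wrt_def by blast
  let ?Y = "gen_eig_sol A \<mu> v (Suc k)" and ?q = "re_im_seminorm p"
  have bound: "?q v \<le> 2 * \<alpha> * ?q v * exp (-\<beta> * t)" if t: "t \<ge> 0" for t
  proof -
    define e where "e = exp (\<mu> * of_real t)"
    have "cmod (inverse e) \<le> 1"
      using \<mu> t by (simp add: e_def norm_inverse exp_minus[symmetric])
    have "?q v = ?q (inverse e *s (e *s v))" by (simp add: e_def)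
    also have "\<dots> \<le> 2 * cmod (inverse e) * ?q (e *s v)" by (rule re_im_seminorm_smult_le[OF p])
    also have "\<dots> \<le> 2 * ?q (e *s v)"
      using \<open>cmod (inverse e) \<le> 1\<close> re_im_seminorm_nonneg[OF p] by (simp add: mult_left_le_one_le)
    also have "?q (e *s v) = ?q (?Y t)"
      using re_im_seminorm_add_complexify[OF p ker gen_eig_sol_diff_in_complexify[OF E inv u, of k t],
          of "e *s v"]
      by (simp add: e_def)
    also have "?q (?Y t) \<le> \<alpha> * ?q v * exp (-\<beta> * t)"
      using re_im_seminorm_bound[OF H csolution_gen_eig_sol[OF chain] t] gen_eig_sol_at_0[OF chain]
      by simp
    finally show ?thesis by simp
  qed
  have "?q v = 0"
  proof (rule ccontr)
    assume "?q v \<noteq> 0"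
    then have "?q v > 0" using re_im_seminorm_nonneg[OF p, of v] by simp
    then obtain t where "t \<ge> 0" "2 * \<alpha> * ?q v * exp (-\<beta> * t) < ?q v"
      using exp_decay_eventually_less[OF _ \<beta>] by blast
    then show False using bound by fastforce
  qed
  then have "p (Re_vec v) = 0" "p (Im_vec v) = 0"
    using seminorm_nonneg[OF p, of "Re_vec v"] seminorm_nonneg[OF p, of "Im_vec v"]
    by (auto simp: re_im_seminorm_def)
  then show ?thesis using ker by (auto simp: complexify_def seminorm_ker_def)
qed

lemma stmt2_imp_stmt1:
  assumes E: "subspace E" and s2: "stmt2 A E"
  shows "stmt1 A E"
proof -
  obtain p where p: "seminorm p" and ker: "seminorm_ker p = E" and ges: "ges_wrt A p"
    using s2 by (auto simp: stmt2_def)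
  have inv: "\<forall>x\<in>E. A *v x \<in> E" using ges_wrt_ker_invariant[OF E p ker ges] by blast
  have "E_ge0 A \<subseteq> E"
    by (rule E_ge0_subsetI[OF E]) (rule ges_wrt_jordan_step[OF E inv p ker ges])
  with inv show ?thesis by (simp add: stmt1_def)
qed

section \<open>Statement (1) implies statement (5)\<close>

definition sym_ker :: "(real^'n) set \<Rightarrow> (real^'n^'n) set" where
  "sym_ker E = {P. transpose P = P \<and> (\<forall>x\<in>E. P *v x = 0)}"

definition lyap :: "real^'n^'n \<Rightarrow> real^'n^'n \<Rightarrow> real^'n^'n" where
  "lyap A P = transpose A ** P + P ** A"

lemma transpose_add: "transpose (P + Q) = transpose P + (transpose Q :: 'a::plus^'n^'m)"
  by (simp add: transpose_def vec_eq_iff)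

lemma matrix_add_rdistrib: "(P + Q) ** (A :: 'a::semiring_1^'n^'m) = P ** A + Q ** A"
  by (simp add: matrix_matrix_mult_def vec_eq_iff distrib_right sum.distrib)

lemma subspace_sym_ker: "subspace (sym_ker E)"
  unfolding subspace_def sym_ker_def
  by (auto simp: transpose_add matrix_vector_mult_add_rdistrib transpose_scalar
      scaleR_matrix_vector_assoc[symmetric]) (simp_all add: transpose_def vec_eq_iff)

lemma linear_lyap: "linear (lyap A)"
  by (rule linearI)
    (simp_all add: lyap_def matrix_add_ldistrib matrix_add_rdistrib matrix_scalar_ac
      scalar_matrix_assoc[symmetric] scaleR_add_right)

lemma lyap_in_sym_ker:
  assumes inv: "\<forall>x\<in>E. A *v x \<in> E" and P: "P \<in> sym_ker E"
  shows "lyap A P \<in> sym_ker E"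
  using P inv
  by (auto simp: sym_ker_def lyap_def transpose_add matrix_transpose_mul add.commute
      matrix_vector_mult_add_rdistrib matrix_vector_mul_assoc[symmetric])

lemma has_real_derivative_quadratic_form:
  assumes X: "solution A X" and P: "transpose P = P"
  shows "((\<lambda>t. X t \<bullet> (P *v X t)) has_real_derivative (X t \<bullet> (lyap A P *v X t))) (at t)"
proof -
  have dX: "(X has_vector_derivative A *v X t) (at t)" using X by (simp add: solution_def)
  have "((\<lambda>t. X t \<bullet> (P *v X t)) has_vector_derivative
      (X t \<bullet> (P *v (A *v X t)) + (A *v X t) \<bullet> (P *v X t))) (at t)"
    by (rule bounded_bilinear.has_vector_derivative[OF bounded_bilinear_inner dX
          bounded_linear.has_vector_derivative[OF matrix_vector_mul_bounded_linear dX]])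
  moreover have "lyap A P *v X t = transpose A *v (P *v X t) + P *v (A *v X t)"
    by (simp only: lyap_def matrix_vector_mult_add_rdistrib matrix_vector_mul_assoc[symmetric])
  then have "X t \<bullet> (P *v (A *v X t)) + (A *v X t) \<bullet> (P *v X t) = X t \<bullet> (lyap A P *v X t)"
    by (simp only: inner_add_right inner_transpose_mult add.commute)
  ultimately show ?thesis by (simp add: has_real_derivative_iff_has_vector_derivative)
qed

lemma abs_quadratic_form_le:
  assumes E: "subspace E" and P: "P \<in> sym_ker E"
  shows "\<bar>y \<bullet> (P *v y)\<bar> \<le> onorm ((*v) P) * (norm (perp_proj E y))^2"
proof -
  define w e where "w = perp_proj E y" and "e = y - perp_proj E y"
  have sym: "transpose P = P" and Pe: "P *v e = 0"
    using P diff_perp_proj_in[OF E, of y] by (auto simp: sym_ker_def e_def)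
  have "e \<bullet> (P *v w) = 0" using inner_symmetric_mult[OF sym, of e w] Pe by simp
  moreover have "y = w + e" by (simp add: w_def e_def)
  ultimately have "y \<bullet> (P *v y) = w \<bullet> (P *v w)"
    using Pe by (simp add: matrix_vector_right_distrib inner_add_left)
  also have "\<bar>\<dots>\<bar> \<le> norm w * norm (P *v w)" by (rule Cauchy_Schwarz_ineq2)
  also have "\<dots> \<le> norm w * (onorm ((*v) P) * norm w)"
    by (intro mult_left_mono onorm[OF matrix_vector_mul_bounded_linear]) simp
  finally show ?thesis by (simp add: w_def power2_eq_square mult_ac)
qed

lemma exp_decaying_quadratic_form:
  assumes E: "subspace E" and ge: "E_ge0 A \<subseteq> E" and P: "P \<in> sym_ker E"
  shows "\<exists>X. solution A X \<and> X 0 = x0 \<and> exp_decaying (\<lambda>t. X t \<bullet> (P *v X t))"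
proof -
  obtain X M \<beta> where X: "solution A X" "X 0 = x0" and \<beta>: "\<beta> > 0"
    and M: "\<forall>t\<ge>0. norm (perp_proj E (X t)) \<le> M * exp (-\<beta> * t)"
    using solution_perp_proj_decaying[OF E ge] unfolding exp_decaying_def by blast
  have "\<bar>X t \<bullet> (P *v X t)\<bar> \<le> (onorm ((*v) P) * M^2) * exp (-(2*\<beta>) * t)" if t: "t \<ge> 0" for t
  proof -
    have "\<bar>X t \<bullet> (P *v X t)\<bar> \<le> onorm ((*v) P) * (norm (perp_proj E (X t)))^2"
      by (rule abs_quadratic_form_le[OF E P])
    also have "\<dots> \<le> onorm ((*v) P) * (M * exp (-\<beta> * t))^2"
      using M t by (intro mult_left_mono power_mono onorm_pos_le[OF matrix_vector_mul_bounded_linear]) auto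
    also have "(M * exp (-\<beta> * t))^2 = M^2 * exp (-(2*\<beta>) * t)"
    proof -
      have "exp (-\<beta> * t) * exp (-\<beta> * t) = exp (-(2*\<beta>) * t)" by (simp flip: exp_add)
      then show ?thesis by (simp add: power2_eq_square algebra_simps)
    qed
    finally show ?thesis by (simp add: mult.assoc)
  qed
  moreover have "2 * \<beta> > 0" using \<beta> by simp
  ultimately have "exp_decaying (\<lambda>t. X t \<bullet> (P *v X t))"
    unfolding exp_decaying_def real_norm_def by blast
  with X show ?thesis by blast
qed

lemma symmetric_quadratic_form_eq_0:
  fixes P :: "real^'n^'n"
  assumes sym: "transpose P = P" and V0: "\<And>x. x \<bullet> (P *v x) = 0"
  shows "P = 0"
proof -
  have "(x + y) \<bullet> (P *v (x + y)) = x \<bullet> (P *v x) + 2 * (x \<bullet> (P *v y)) + y \<bullet> (P *v y)" for x y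
    using inner_symmetric_mult[OF sym, of y x]
    by (simp add: matrix_vector_right_distrib inner_add_left inner_add_right inner_commute)
  then have "x \<bullet> (P *v y) = 0" for x y using V0 by simp
  then have "P *v y = 0" for y by (metis inner_eq_zero_iff)
  then show ?thesis by (simp add: matrix_eq)
qed

lemma lyap_eq_0_imp:
  assumes E: "subspace E" and ge: "E_ge0 A \<subseteq> E" and P: "P \<in> sym_ker E" and L0: "lyap A P = 0"
  shows "P = 0"
proof (rule symmetric_quadratic_form_eq_0)
  show sym: "transpose P = P" using P by (simp add: sym_ker_def)
  fix x0
  obtain X where X: "solution A X" "X 0 = x0" and dec: "exp_decaying (\<lambda>t. X t \<bullet> (P *v X t))"
    using exp_decaying_quadratic_form[OF E ge P] by blast
  have "X t \<bullet> (P *v X t) = X 0 \<bullet> (P *v X 0)" for t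
    using has_real_derivative_quadratic_form[OF X(1) sym] L0 by (intro DERIV_isconst_all) simp
  then have "(\<lambda>t. X t \<bullet> (P *v X t)) = (\<lambda>t. x0 \<bullet> (P *v x0))" using X(2) by simp
  then show "x0 \<bullet> (P *v x0) = 0" using exp_decaying_const dec by metis
qed

text \<open>An injective endomorphism of the finite-dimensional space \<open>sym_ker E\<close> is onto.\<close>
lemma lyap_onto_sym_ker:
  assumes E: "subspace E" and inv: "\<forall>x\<in>E. A *v x \<in> E" and ge: "E_ge0 A \<subseteq> E"
    and R: "R \<in> sym_ker E"
  shows "\<exists>P\<in>sym_ker E. lyap A P = R"
proof -
  have inj: "inj_on (lyap A) (sym_ker E)"
  proof (rule inj_onI)
    fix P1 P2 assume "P1 \<in> sym_ker E" "P2 \<in> sym_ker E" "lyap A P1 = lyap A P2"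
    then have "P1 - P2 \<in> sym_ker E" "lyap A (P1 - P2) = 0"
      by (simp_all add: subspace_diff[OF subspace_sym_ker] linear_diff[OF linear_lyap])
    then have "P1 - P2 = 0" by (rule lyap_eq_0_imp[OF E ge])
    then show "P1 = P2" by simp
  qed
  have "dim (lyap A ` sym_ker E) = dim (sym_ker E)"
    using inj subspace_sym_ker
    by (intro eucl.dim_image_eq[OF linear_lyap]) (simp add: span_eq_iff[THEN iffD2, OF subspace_sym_ker])
  moreover have "lyap A ` sym_ker E \<subseteq> sym_ker E" using lyap_in_sym_ker[OF inv] by blast
  ultimately have "lyap A ` sym_ker E = sym_ker E"
    by (intro subspace_dim_equal linear_subspace_image[OF linear_lyap subspace_sym_ker]
        subspace_sym_ker) simp_all
  then show ?thesis using R by (metis imageE)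
qed

lemma lyap_solution_psd:
  assumes E: "subspace E" and ge: "E_ge0 A \<subseteq> E" and P: "P \<in> sym_ker E"
    and eq: "lyap A P + Q = 0" and Q: "\<forall>x. 0 \<le> x \<bullet> (Q *v x)"
  shows "0 \<le> x0 \<bullet> (P *v x0)"
proof -
  have sym: "transpose P = P" using P by (simp add: sym_ker_def)
  obtain X where X: "solution A X" "X 0 = x0" and dec: "exp_decaying (\<lambda>t. X t \<bullet> (P *v X t))"
    using exp_decaying_quadratic_form[OF E ge P] by blast
  have "lyap A P *v x + Q *v x = 0" for x
    using eq by (simp flip: matrix_vector_mult_add_rdistrib)
  then have "X s \<bullet> (lyap A P *v X s) \<le> 0" for s
    using Q by (simp add: eq_neg_iff_add_eq_0[symmetric])
  have "X t \<bullet> (P *v X t) \<le> X 0 \<bullet> (P *v X 0)" if t: "t \<ge> 0" for t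
  proof (rule DERIV_nonpos_imp_decreasing_open[OF t])
    fix s
    show "\<exists>y. ((\<lambda>t. X t \<bullet> (P *v X t)) has_real_derivative y) (at s) \<and> y \<le> 0"
      using has_real_derivative_quadratic_form[OF X(1) sym] \<open>\<And>s. X s \<bullet> (lyap A P *v X s) \<le> 0\<close> by blast
  next
    show "continuous_on {0..t} (\<lambda>t. X t \<bullet> (P *v X t))"
      by (rule DERIV_continuous_on[OF DERIV_subset[OF has_real_derivative_quadratic_form[OF X(1) sym]]])
        auto
  qed
  then show ?thesis using exp_decaying_nonneg[OF dec] X(2) by simp
qed

lemma lyap_solution_ker:
  assumes P: "P \<in> sym_ker E" and Q: "Q \<in> psd_ker E" and eq: "lyap A P + Q = 0"
    and Px: "P *v x = 0"
  shows "x \<in> E"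
proof -
  have sym: "transpose P = P" using P by (simp add: sym_ker_def)
  have "transpose A *v (P *v x) + P *v (A *v x) + Q *v x = 0"
    using lyapunov_mult[of A P Q x] eq by (simp add: lyap_def)
  moreover have "x \<bullet> (P *v (A *v x)) = 0" using inner_symmetric_mult[OF sym, of x "A *v x"] Px by simp
  ultimately have "x \<bullet> (Q *v x) = 0" using Px by (metis add_0 inner_add_right inner_zero_right matrix_vector_mult_0_right)
  then have "Q *v x = 0" using Q psd_mult_eq_0 by (auto simp: psd_ker_def)
  then show ?thesis using Q by (auto simp: psd_ker_def)
qed

lemma stmt1_imp_stmt5:
  assumes E: "subspace E" and s1: "stmt1 A E"
  shows "stmt5 A E"
  unfolding stmt5_def
proof
  fix Q assume Q: "Q \<in> psd_ker E"
  have inv: "\<forall>x\<in>E. A *v x \<in> E" and ge: "E_ge0 A \<subseteq> E" using s1 by (auto simp: stmt1_def)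
  have psd_ker_sym_ker: "psd_ker E \<subseteq> sym_ker E" by (auto simp: psd_ker_def sym_ker_def)
  have eq_iff: "transpose A ** P + P ** A + Q = 0 \<longleftrightarrow> lyap A P + Q = 0" for P by (simp add: lyap_def)
  obtain P where P: "P \<in> sym_ker E" and "lyap A P = - Q"
    using lyap_onto_sym_ker[OF E inv ge] subspace_neg[OF subspace_sym_ker] Q psd_ker_sym_ker by blast
  then have eq: "lyap A P + Q = 0" by simp
  have "P \<in> psd_ker E"
    using P lyap_solution_psd[OF E ge P eq] lyap_solution_ker[OF P Q eq] Q
    by (auto simp: psd_ker_def sym_ker_def)
  moreover have "P' = P" if "P' \<in> psd_ker E" "lyap A P' + Q = 0" for P'
  proof -
    have "P' - P \<in> sym_ker E" using that(1) P psd_ker_sym_ker by (blast intro: subspace_diff[OF subspace_sym_ker])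
    moreover have "lyap A P' = lyap A P" using that(2) eq by (metis add_right_cancel)
    then have "lyap A (P' - P) = 0" by (simp add: linear_diff[OF linear_lyap])
    ultimately show ?thesis using lyap_eq_0_imp[OF E ge] by fastforce
  qed
  ultimately show "\<exists>!P. P \<in> psd_ker E \<and> transpose A ** P + P ** A + Q = 0"
    unfolding eq_iff using eq by blast
qed

lemma stmt5_imp_stmt4: "subspace E \<Longrightarrow> stmt5 A E \<Longrightarrow> stmt4 A E"
  unfolding stmt5_def stmt4_def using perp_proj_mat_in_psd_ker by blast

lemma stmts_equivalent:
  assumes "subspace E"
  shows "(stmt1 A E \<longleftrightarrow> stmt2 A E) \<and> (stmt1 A E \<longleftrightarrow> stmt3 A E) \<and>
         (stmt1 A E \<longleftrightarrow> stmt4 A E) \<and> (stmt1 A E \<longleftrightarrow> stmt5 A E)"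
  using stmt1_imp_stmt3[OF assms] stmt3_imp_stmt2[OF assms] stmt2_imp_stmt1[OF assms]
    stmt1_imp_stmt5[OF assms] stmt5_imp_stmt4[OF assms] stmt4_imp_stmt1[OF assms]
  by blast

theorem theorem3:
  fixes A :: "real^'n^'n"
  shows "(\<forall>E :: (real^'n) set. subspace E \<longrightarrow>
            (stmt1 A E \<longleftrightarrow> stmt2 A E) \<and> (stmt1 A E \<longleftrightarrow> stmt3 A E) \<and>
            (stmt1 A E \<longleftrightarrow> stmt4 A E) \<and> (stmt1 A E \<longleftrightarrow> stmt5 A E))
   \<and> subspace (E_ge0 A)
   \<and> stmt1 A (E_ge0 A) \<and> stmt2 A (E_ge0 A) \<and> stmt3 A (E_ge0 A) \<and> stmt4 A (E_ge0 A) \<and> stmt5 A (E_ge0 A)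
   \<and> (\<forall>E. subspace E \<and> (stmt1 A E \<or> stmt2 A E \<or> stmt3 A E \<or> stmt4 A E \<or> stmt5 A E)
          \<longrightarrow> E_ge0 A \<subseteq> E)"
proof -
  have "stmt1 A (E_ge0 A)" unfolding stmt1_def using E_ge0_invariant by blast
  moreover have "E_ge0 A \<subseteq> E" if "subspace E" "stmt1 A E" for E
    using that(2) by (simp add: stmt1_def)
  ultimately show ?thesis using stmts_equivalent subspace_E_ge0 by blast
qed

end
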